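(* Let $G$ be a locally compact Hausdorff topological group. For each $n\in\mathbb N$, the following are equivalent: 1. $G$ is of type $\mathrm C_n$; 2. $0\in\Sigma^n_{\mathrm{top}}(G)$; 3. $\Sigma^n_{\mathrm{top}}(G)\neq\emptyset$.
   Context: $\mathbb N$ contains $0$. A character on $G$ is a continuous homomorphism $\chi\colon G\to\mathbb R$; $G_\chi:=\{g\in G\mid\chi(g)\ge0\}$; $0$ denotes the zero character. For a set $S$, $\mathrm E S$ is the simplicial set with $n$-simplices $S^{n+1}$, the $i$-th face (degeneracy) map deleting (doubling) the $i$-th entry. $\mathcal C(G)$ is the poset of compact subsets of $G$ ordered by inclusion. For $C\in\mathcal C(G)$, $G_\chi\cdot\mathrm E C\subseteq \mathrm E G$ is the simplicial subset of all simplices $(gx_0,\dots,gx_k)$ with $g\in G_\chi$, $x_i\in C$; $G\cdot\mathrm E C$ is defined the same way with $g\in G$. A filtration $(X_\alpha)_{\alpha\in A}$ of a connected simplicial set $X$ over a directed poset $A$ (simplicial subsets, increasing in $\alpha$, with union $X$) is essentially $n$-connected if for a vertex $x\in X$ (the choice is immaterial), every $k$ with $0\le k\le n$ and every $\alpha$ with $x\in X_\alpha$, there is $\beta\ge\alpha$ such that $\pi_k(X_\alpha,x)\to\pi_k(X_\beta,x)$ is trivial (homotopy groups are those of geometric realizations); essentially $(-1)$-connected is a vacuous condition. $G$ is of type $\mathrm C_n$ if the filtration $(G\cdot\mathrm E C)_{C\in\mathcal C(G)}$ of $\mathrm E G$ is essentially $(n-1)$-connected. $\Sigma^n_{\mathrm{top}}(G)$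 is the set of characters $\chi$ for which the filtration $(G_\chi\cdot \mathrm E C)_{C\in\mathcal C(G)}$ of $\mathrm E G$ is essentially $(n-1)$-connected. *)

theory Defs
  imports "HOL-Analysis.Analysis" "HOL-Homology.Homology"
begin

section \<open>Simplicial sets\<close>

text \<open>\<open>face X n i\<close> maps \<open>n\<close>-simplices to \<open>(n-1)\<close>-simplices, for \<open>n \<ge> 1\<close> and \<open>i \<le> n\<close>;
  \<open>degen X n i\<close> maps \<open>n\<close>-simplices to \<open>(n+1)\<close>-simplices, for \<open>i \<le> n\<close>.\<close>

record 'a sset =
  simplices :: "nat \<Rightarrow> 'a set"
  face :: "nat \<Rightarrow> nat \<Rightarrow> 'a \<Rightarrow> 'a"
  degen :: "nat \<Rightarrow> nat \<Rightarrow> 'a \<Rightarrow> 'a"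

definition simplicial_set :: "'a sset \<Rightarrow> bool" where
  "simplicial_set X \<longleftrightarrow>
    (\<forall>n. \<forall>i\<le>Suc n. \<forall>x\<in>simplices X (Suc n). face X (Suc n) i x \<in> simplices X n) \<and>
    (\<forall>n. \<forall>i\<le>n. \<forall>x\<in>simplices X n. degen X n i x \<in> simplices X (Suc n)) \<and>
    (\<forall>n. \<forall>x\<in>simplices X (Suc (Suc n)). \<forall>j\<le>Suc (Suc n). \<forall>i<j.
       face X (Suc n) i (face X (Suc (Suc n)) j x)
         = face X (Suc n) (j - 1) (face X (Suc (Suc n)) i x)) \<and>
    (\<forall>n. \<forall>x\<in>simplices X n. \<forall>j\<le>n. \<forall>i\<le>j.
       degen X (Suc n) i (degen X n j x) = degen X (Suc n) (Suc j) (degen X n i x)) \<and>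
    (\<forall>n. \<forall>x\<in>simplices X n. \<forall>j\<le>n. \<forall>i\<le>Suc n.
       face X (Suc n) i (degen X n j x)
         = (if i < j then degen X (n - 1) (j - 1) (face X n i x)
            else if i \<le> Suc j then x
            else degen X (n - 1) j (face X n (i - 1) x)))"

definition simplicial_subset :: "'a sset \<Rightarrow> 'a sset \<Rightarrow> bool" where
  "simplicial_subset Y X \<longleftrightarrow>
    face Y = face X \<and> degen Y = degen X \<and>
    (\<forall>n. simplices Y n \<subseteq> simplices X n) \<and>
    (\<forall>n. \<forall>i\<le>Suc n. \<forall>x\<in>simplices Y (Suc n). face X (Suc n) i x \<in> simplices Y n) \<and>
    (\<forall>n. \<forall>i\<le>n. \<forall>x\<in>simplices Y n. degen X n i x \<in> simplices Y (Suc n))"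

text \<open>An \<open>n\<close>-simplex \<open>(x\<^sub>0,\<dots>,x\<^sub>n)\<close> of \<open>E S\<close> is the list of length \<open>n + 1\<close> of its entries.\<close>

definition ESet :: "'a set \<Rightarrow> 'a list sset" where
  "ESet S = \<lparr>simplices = (\<lambda>n. {xs. length xs = Suc n \<and> set xs \<subseteq> S}),
             face = (\<lambda>n i xs. take i xs @ drop (Suc i) xs),
             degen = (\<lambda>n i xs. take (Suc i) xs @ drop i xs)\<rparr>"


section \<open>Geometric realization\<close>

definition quotient_topology :: "'a topology \<Rightarrow> ('a \<times> 'a) set \<Rightarrow> 'a set topology" where
  "quotient_topology T R = topology (\<lambda>\<U>. \<U> \<subseteq> topspace T // R \<and> openin T (\<Union>\<U>))"

text \<open>The coproduct of the spaces \<open>X\<^sub>n \<times> \<Delta>\<^sup>n\<close> with \<open>X\<^sub>n\<close> discrete. Its points are \<open>((n, x), t)\<close>.\<close>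

definition simplex_coproduct :: "'a sset \<Rightarrow> ((nat \<times> 'a) \<times> (nat \<Rightarrow> real)) topology" where
  "simplex_coproduct X =
    sum_topology (\<lambda>(n, x). subtopology (powertop_real UNIV) (standard_simplex n))
                 (SIGMA n:UNIV. simplices X n)"

text \<open>The map \<open>\<Delta>\<^sup>n\<^sup>+\<^sup>1 \<rightarrow> \<Delta>\<^sup>n\<close> induced by the surjection that hits \<open>i\<close> twice. Its counterpart for the
  injection that omits \<open>i\<close> is \<^const>\<open>simplical_face\<close>.\<close>

definition simplicial_degen :: "nat \<Rightarrow> (nat \<Rightarrow> real) \<Rightarrow> nat \<Rightarrow> real" where
  "simplicial_degen i t =
    (\<lambda>j. if j < i then t j else if j = i then t i + t (Suc i) else t (Suc j))"

inductive glue :: "'a sset \<Rightarrow> (nat \<times> 'a) \<times> (nat \<Rightarrow> real) \<Rightarrow> (nat \<times> 'a) \<times> (nat \<Rightarrow> real) \<Rightarrow> bool"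
  for X :: "'a sset" where
  face: "\<lbrakk>x \<in> simplices X (Suc n); i \<le> Suc n; t \<in> standard_simplex n\<rbrakk>
    \<Longrightarrow> glue X ((n, face X (Suc n) i x), t) ((Suc n, x), simplical_face i t)"
| degen: "\<lbrakk>x \<in> simplices X n; i \<le> n; t \<in> standard_simplex (Suc n)\<rbrakk>
    \<Longrightarrow> glue X ((Suc n, degen X n i x), t) ((n, x), simplicial_degen i t)"

definition realization_rel ::
  "'a sset \<Rightarrow> (((nat \<times> 'a) \<times> (nat \<Rightarrow> real)) \<times> ((nat \<times> 'a) \<times> (nat \<Rightarrow> real))) set" where
  "realization_rel X =
    {(p, q). p \<in> topspace (simplex_coproduct X) \<and> q \<in> topspace (simplex_coproduct X)
       \<and> equivclp (glue X) p q}"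

definition realization :: "'a sset \<Rightarrow> ((nat \<times> 'a) \<times> (nat \<Rightarrow> real)) set topology" where
  "realization X = quotient_topology (simplex_coproduct X) (realization_rel X)"

definition realization_vertex :: "'a sset \<Rightarrow> 'a \<Rightarrow> ((nat \<times> 'a) \<times> (nat \<Rightarrow> real)) set" where
  "realization_vertex X x = realization_rel X `` {((0, x), \<lambda>i. if i = 0 then 1 else 0)}"

text \<open>The map of realizations induced by the inclusion of a simplicial subset into \<open>Y\<close>. It sends the
  class of a point to the class of the same point in the realization of \<open>Y\<close>, which may be larger.\<close>

definition realization_incl ::
  "'a sset \<Rightarrow> ((nat \<times> 'a) \<times> (nat \<Rightarrow> real)) set \<Rightarrow> ((nat \<times> 'a) \<times> (nat \<Rightarrow> real)) set" where
  "realization_incl Y c = realization_rel Y `` c"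


section \<open>Homotopy groups\<close>

text \<open>The \<open>k\<close>-cube; for \<open>k = 0\<close> it is a point with empty boundary.\<close>

definition cube :: "nat \<Rightarrow> (nat \<Rightarrow> real) topology" where
  "cube k = product_topology (\<lambda>_. top_of_set {0..1}) {..<k}"

definition cube_boundary :: "nat \<Rightarrow> (nat \<Rightarrow> real) set" where
  "cube_boundary k = {t \<in> topspace (cube k). \<exists>i<k. t i = 0 \<or> t i = 1}"

definition based_maps :: "nat \<Rightarrow> 'a topology \<Rightarrow> 'a \<Rightarrow> ((nat \<Rightarrow> real) \<Rightarrow> 'a) set" where
  "based_maps k T x = {f. continuous_map (cube k) T f \<and> (\<forall>t\<in>cube_boundary k. f t = x)}"

definition based_homotopy_rel ::
  "nat \<Rightarrow> 'a topology \<Rightarrow> 'a \<Rightarrow> (((nat \<Rightarrow> real) \<Rightarrow> 'a) \<times> ((nat \<Rightarrow> real) \<Rightarrow> 'a)) set" where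
  "based_homotopy_rel k T x =
    {(f, g). f \<in> based_maps k T x \<and> g \<in> based_maps k T x \<and>
       homotopic_with (\<lambda>h. \<forall>t\<in>cube_boundary k. h t = x) (cube k) T f g}"

text \<open>Only the underlying pointed set of \<open>\<pi>\<^sub>k\<close> is needed. Its base point, which is the neutral
  element of the group for \<open>k \<ge> 1\<close>, is the class of the constant map.\<close>

definition homotopy_group :: "nat \<Rightarrow> 'a topology \<Rightarrow> 'a \<Rightarrow> ((nat \<Rightarrow> real) \<Rightarrow> 'a) set set" where
  "homotopy_group k T x = based_maps k T x // based_homotopy_rel k T x"

definition homotopy_unit :: "nat \<Rightarrow> 'a topology \<Rightarrow> 'a \<Rightarrow> ((nat \<Rightarrow> real) \<Rightarrow> 'a) set" where
  "homotopy_unit k T x = based_homotopy_rel k T x `` {\<lambda>_. x}"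

definition homotopy_induced ::
  "nat \<Rightarrow> 'b topology \<Rightarrow> 'b \<Rightarrow> ('a \<Rightarrow> 'b) \<Rightarrow> ((nat \<Rightarrow> real) \<Rightarrow> 'a) set \<Rightarrow> ((nat \<Rightarrow> real) \<Rightarrow> 'b) set" where
  "homotopy_induced k T y \<phi> c = based_homotopy_rel k T y `` ((\<circ>) \<phi> ` c)"


section \<open>Filtrations\<close>

definition filtration :: "'i::order set \<Rightarrow> 'a sset \<Rightarrow> ('i \<Rightarrow> 'a sset) \<Rightarrow> bool" where
  "filtration A X F \<longleftrightarrow>
    A \<noteq> {} \<and> (\<forall>\<alpha>\<in>A. \<forall>\<beta>\<in>A. \<exists>\<gamma>\<in>A. \<alpha> \<le> \<gamma> \<and> \<beta> \<le> \<gamma>) \<and>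
    (\<forall>\<alpha>\<in>A. simplicial_subset (F \<alpha>) X) \<and>
    (\<forall>\<alpha>\<in>A. \<forall>\<beta>\<in>A. \<alpha> \<le> \<beta> \<longrightarrow> (\<forall>n. simplices (F \<alpha>) n \<subseteq> simplices (F \<beta>) n)) \<and>
    (\<forall>n. (\<Union>\<alpha>\<in>A. simplices (F \<alpha>) n) = simplices X n)"

text \<open>Meaningful for a filtration \<open>F\<close> of a connected simplicial set \<open>X\<close>, where a single base vertex
  suffices. The degree \<open>m\<close> is an integer to allow for \<open>m = -1\<close>.\<close>

definition essentially_connected ::
  "'i::order set \<Rightarrow> 'a sset \<Rightarrow> ('i \<Rightarrow> 'a sset) \<Rightarrow> int \<Rightarrow> bool" where
  "essentially_connected A X F m \<longleftrightarrow>
    (\<forall>x\<in>simplices X 0. \<forall>k. int k \<le> m \<longrightarrow>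
      (\<forall>\<alpha>\<in>A. x \<in> simplices (F \<alpha>) 0 \<longrightarrow>
        (\<exists>\<beta>\<in>A. \<alpha> \<le> \<beta> \<and>
          (\<forall>c\<in>homotopy_group k (realization (F \<alpha>)) (realization_vertex (F \<alpha>) x).
             homotopy_induced k (realization (F \<beta>)) (realization_vertex (F \<beta>) x)
                 (realization_incl (F \<beta>)) c
               = homotopy_unit k (realization (F \<beta>)) (realization_vertex (F \<beta>) x)))))"


section \<open>Topological groups\<close>

text \<open>Groups are written additively but not assumed commutative, as in the class
  \<^class>\<open>topological_group_add\<close>.\<close>

definition character :: "('g::topological_group_add \<Rightarrow> real) \<Rightarrow> bool" where
  "character \<xi> \<longleftrightarrow> continuous_on UNIV \<xi> \<and> (\<forall>g h. \<xi> (g + h) = \<xi> g + \<xi> h)"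

text \<open>\<open>translates H C\<close> is the simplicial subset \<open>H \<cdot> E C\<close> of \<open>E G\<close>.\<close>

definition translates :: "'g::group_add set \<Rightarrow> 'g set \<Rightarrow> 'g list sset" where
  "translates H C =
    (ESet UNIV)\<lparr>simplices := (\<lambda>n. {map ((+) g) xs | g xs. g \<in> H \<and> xs \<in> simplices (ESet C) n})\<rparr>"

definition type_C :: "'g::topological_group_add itself \<Rightarrow> nat \<Rightarrow> bool" where
  "type_C _ n \<longleftrightarrow>
    essentially_connected {C :: 'g set. compact C} (ESet UNIV) (translates UNIV) (int n - 1)"

definition Sigma_top :: "nat \<Rightarrow> ('g::topological_group_add \<Rightarrow> real) set" where
  "Sigma_top n =
    {\<xi>. character \<xi> \<and>
       essentially_connected {C. compact C} (ESet UNIV) (translates {g. 0 \<le> \<xi> g}) (int n - 1)}"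


section \<open>Well-definedness\<close>

lemma istopology_quotient:
  assumes "equiv (topspace T) R"
  shows "istopology (\<lambda>\<U>. \<U> \<subseteq> topspace T // R \<and> openin T (\<Union>\<U>))"
  unfolding istopology_def
proof (intro conjI allI impI; (elim conjE)?)
  fix S U assume S: "S \<subseteq> topspace T // R" "openin T (\<Union>S)" and U: "U \<subseteq> topspace T // R" "openin T (\<Union>U)"
  have "\<Union>(S \<inter> U) = \<Union>S \<inter> \<Union>U"
  proof
    show "\<Union>S \<inter> \<Union>U \<subseteq> \<Union>(S \<inter> U)"
    proof
      fix p assume "p \<in> \<Union>S \<inter> \<Union>U"
      then obtain a b where ab: "a \<in> S" "b \<in> U" "p \<in> a" "p \<in> b" by auto
      then have "a = b" using quotient_disj[OF assms, of a b] S U by blast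
      then show "p \<in> \<Union>(S \<inter> U)" using ab by auto
    qed
  qed auto
  then show "openin T (\<Union>(S \<inter> U))" using S U by auto
  show "S \<inter> U \<subseteq> topspace T // R" using S by auto
next
  fix K assume K: "\<forall>U\<in>K. U \<subseteq> topspace T // R \<and> openin T (\<Union>U)"
  show "\<Union>K \<subseteq> topspace T // R" using K by auto
  have "\<Union>(\<Union>K) = \<Union>(Union ` K)" by auto
  then show "openin T (\<Union>(\<Union>K))" using K by (metis (no_types, lifting) imageE openin_Union)
qed

lemma openin_quotient_topology:
  assumes "equiv (topspace T) R"
  shows "openin (quotient_topology T R) U \<longleftrightarrow> U \<subseteq> topspace T // R \<and> openin T (\<Union>U)"
  unfolding quotient_topology_def using topology_inverse'[OF istopology_quotient[OF assms]] by simp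

lemma topspace_quotient_topology:
  assumes "equiv (topspace T) R"
  shows "topspace (quotient_topology T R) = topspace T // R"
proof -
  have "openin (quotient_topology T R) (topspace T // R)"
    by (simp add: openin_quotient_topology[OF assms] Union_quotient[OF assms])
  then show ?thesis
    using openin_quotient_topology[OF assms] by (metis openin_subset openin_topspace subset_antisym)
qed

lemma equiv_realization_rel: "equiv (topspace (simplex_coproduct X)) (realization_rel X)"
proof (rule equivI)
  show "realization_rel X \<subseteq> topspace (simplex_coproduct X) \<times> topspace (simplex_coproduct X)"
    by (auto simp: realization_rel_def)
  show "refl_on (topspace (simplex_coproduct X)) (realization_rel X)"
    by (simp add: refl_on_def realization_rel_def equivp_reflp[OF equivp_evquivclp])
  show "sym (realization_rel X)"
    by (simp add: sym_def realization_rel_def equivp_symp[OF equivp_evquivclp])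
  show "trans (realization_rel X)"
    unfolding trans_def realization_rel_def
    using equivp_transp[OF equivp_evquivclp, of "glue X"] by blast
qed

lemma equiv_based_homotopy_rel: "equiv (based_maps k T x) (based_homotopy_rel k T x)"
proof (rule equivI)
  show "based_homotopy_rel k T x \<subseteq> based_maps k T x \<times> based_maps k T x"
    by (auto simp: based_homotopy_rel_def)
  show "refl_on (based_maps k T x) (based_homotopy_rel k T x)"
    by (simp add: refl_on_def based_homotopy_rel_def based_maps_def)
  show "sym (based_homotopy_rel k T x)"
    by (simp add: sym_def based_homotopy_rel_def homotopic_with_sym)
  show "trans (based_homotopy_rel k T x)"
    unfolding trans_def based_homotopy_rel_def using homotopic_with_trans by blast
qed

lemma simplicial_set_ESet: "simplicial_set (ESet S)"
proof -
  define del :: "nat \<Rightarrow> 'a list \<Rightarrow> 'a list" where "del i xs = take i xs @ drop (Suc i) xs" for i xs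
  define dup :: "nat \<Rightarrow> 'a list \<Rightarrow> 'a list" where "dup i xs = take (Suc i) xs @ drop i xs" for i xs
  have len [simp]: "length (del i xs) = length xs - 1" "length (dup i xs) = Suc (length xs)"
    if "i < length xs" for i xs
    using that by (auto simp: del_def dup_def)
  have nth_del: "del i xs ! m = (if m < i then xs ! m else xs ! Suc m)"
    if "i < length xs" "Suc m < length xs" for i m xs
    using that by (simp add: del_def nth_append min_def)
  have nth_dup: "dup i xs ! m = (if m \<le> i then xs ! m else xs ! (m - 1))"
    if "i < length xs" "m \<le> length xs" for i m xs
    using that by (auto simp: dup_def nth_append min_def not_le less_Suc_eq_le intro!: arg_cong[where f = "(!) xs"])
  have del_del: "del i (del j xs) = del (j - 1) (del i xs)" if "i < j" "j < length xs" for i j xs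
    by (rule nth_equalityI) (use that in \<open>auto simp: nth_del\<close>)
  have dup_dup: "dup i (dup j xs) = dup (Suc j) (dup i xs)" if "i \<le> j" "j < length xs" for i j xs
    by (rule nth_equalityI) (use that in \<open>auto simp: nth_dup\<close>)
  have del_dup: "del i (dup j xs) = dup (j - 1) (del i xs)" if "i < j" "j < length xs" for i j xs
    by (rule nth_equalityI) (use that in \<open>auto simp: nth_dup nth_del\<close>)
  have del_dup_id: "del i (dup j xs) = xs" if "j \<le> i" "i \<le> Suc j" "j < length xs" for i j xs
    by (rule nth_equalityI) (use that in \<open>auto simp: nth_dup nth_del\<close>)
  have del_dup': "del i (dup j xs) = dup j (del (i - 1) xs)"
    if "Suc j < i" "i \<le> length xs" for i j xs
    by (rule nth_equalityI) (use that in \<open>auto simp: nth_dup nth_del\<close>)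
  have sub: "set (del i xs) \<subseteq> set xs" "set (dup i xs) \<subseteq> set xs" for i xs
    by (auto simp: del_def dup_def dest: in_set_takeD in_set_dropD)
  have E: "ESet S = \<lparr>simplices = (\<lambda>n. {xs. length xs = Suc n \<and> set xs \<subseteq> S}),
             face = (\<lambda>n. del), degen = (\<lambda>n. dup)\<rparr>"
    by (simp add: ESet_def del_def dup_def fun_eq_iff)
  show ?thesis
    unfolding simplicial_set_def E sset.simps
    using sub by (fastforce simp: del_del dup_dup del_dup del_dup_id del_dup')
qed

lemma filtration_translates:
  fixes H :: "'g::topological_group_add set"
  assumes "0 \<in> H"
  shows "filtration {C. compact C} (ESet UNIV) (translates H)"
  unfolding filtration_def
proof (intro conjI ballI allI impI)
  show "{C::'g set. compact C} \<noteq> {}" by auto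
  fix C D :: "'g set" assume "C \<in> {C. compact C}" "D \<in> {C. compact C}"
  then show "\<exists>E\<in>{C. compact C}. C \<subseteq> E \<and> D \<subseteq> E"
    by (intro bexI[of _ "C \<union> D"]) auto
next
  fix C :: "'g set"
  have closed: "take i (map ((+) g) xs) @ drop j (map ((+) g) xs)
      \<in> {map ((+) g) xs | g xs. g \<in> H \<and> length xs = Suc n \<and> set xs \<subseteq> C}"
    if "g \<in> H" "set xs \<subseteq> C" "length (take i xs @ drop j xs) = Suc n" for g xs i j n
  proof -
    have "set (take i xs @ drop j xs) \<subseteq> C"
      using that by (auto dest: in_set_takeD in_set_dropD)
    then show ?thesis using that
      by (intro CollectI exI[of _ g] exI[of _ "take i xs @ drop j xs"]) (simp add: take_map drop_map)
  qed
  show "simplicial_subset (translates H C) (ESet UNIV)"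
    unfolding simplicial_subset_def translates_def ESet_def
  proof (clarsimp, intro conjI allI impI; clarify)
    fix n i g and xs :: "'g list"
    assume a: "g \<in> H" "length xs = Suc (Suc n)" "set xs \<subseteq> C" "i \<le> Suc n"
    then have "length (take i xs @ drop (Suc i) xs) = Suc n" by simp
    from closed[OF a(1,3) this]
    show "\<exists>h ys. take i (map ((+) g) xs) @ drop (Suc i) (map ((+) g) xs) = map ((+) h) ys
      \<and> h \<in> H \<and> length ys = Suc n \<and> set ys \<subseteq> C"
      by blast
  next
    fix n i g and xs :: "'g list"
    assume a: "g \<in> H" "length xs = Suc n" "set xs \<subseteq> C" "i \<le> n"
    then have "length (take (Suc i) xs @ drop i xs) = Suc (Suc n)" by simp
    from closed[OF a(1,3) this]
    show "\<exists>h ys. take (Suc i) (map ((+) g) xs) @ drop i (map ((+) g) xs) = map ((+) h) ys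
      \<and> h \<in> H \<and> length ys = Suc (Suc n) \<and> set ys \<subseteq> C"
      by blast
  qed simp
next
  fix C D :: "'g set" and n assume "C \<le> D"
  then show "simplices (translates H C) n \<subseteq> simplices (translates H D) n"
    by (fastforce simp: translates_def ESet_def)
next
  fix n
  have "xs \<in> simplices (translates H (set xs)) n" if "length xs = Suc n" for xs
  proof -
    have "xs = map ((+) 0) xs" by (simp add: map_idI)
    then show ?thesis using that assms unfolding translates_def ESet_def by fastforce
  qed
  moreover have "length xs = Suc n" if "xs \<in> simplices (translates H C) n" for xs C
    using that unfolding translates_def ESet_def by auto
  ultimately show "(\<Union>C\<in>{C. compact C}. simplices (translates H C) n) = simplices (ESet UNIV) n"
    by (auto simp: ESet_def intro: finite_imp_compact)
qed

end

(* Only the passage from a nonzero character xi in Sigma^n to type C_n needs work. Fix t with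
   xi(t) > 0. A sphere in |G E C| is compact, hence lies in the part spanned by the translates g C with
   xi(g) >= -m xi(t) for some m, and left multiplication by t^m moves it into |G_xi E C|. For the base
   vertex a, the edges t^j (a, t a) form a path in |G_xi E (C union {a, t a})| from a to t^m a, so the moved
   sphere can be based at a, independently of m. It therefore bounds in |G_xi E D| for a D depending
   only on C, and moving back by t^-m shows that the original sphere bounds in |G E D|.

   Compactness of spheres can be used because two points of a realization agree iff they define the
   same step function on [0, 1) with values in G. The measures of the level sets of a step function
   on [0, r) depend continuously on the point, so points are closed, and realizations of subcomplexes
   are closed subspaces. *)
theory Submission
  imports Defs
begin

section \<open>Weighted words\<close>

text \<open>A stage \<open>D\<close> must be found before the sphere is known, whereas m grows with
  the sphere. Enlarging C until it contains t^m a would make \<open>D\<close> depend on the sphere;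
  the path of edges keeps everything in one complex, so the hypothesis is invoked for a single
  compact set and a single vertex.

  The realization of a subcomplex is a quotient space of its own, whose classes may be smaller sets,
  and not by construction a subspace of the ambient realization. Translation by t^m is available as
  a map into the \<xi>-nonnegative part only on such a subcomplex, so a sphere must be lifted to it
  continuously. This is why closed embeddings are needed, and with them a criterion for equality of
  points that does not depend on the subcomplex. Normal forms give such a criterion but jump when a
  weight tends to zero. The measures \<open>occ\<close> are attached to every representative,
  separate the normal forms and vary continuously, which turns equality into closed conditions on
  each simplex.\<close>

text \<open>A point \<open>[(x\<^sub>0,\<dots>,x\<^sub>n), t]\<close> of the realization is regarded as the step function on \<open>[0, 1)\<close> with
  value \<open>x\<^sub>i\<close> on the \<open>i\<close>-th of consecutive intervals of lengths \<open>t\<^sub>0,\<dots>,t\<^sub>n\<close>; \<open>occ ws a r\<close> is the measure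
  of the set of \<open>s < r\<close> with value \<open>a\<close>, for \<open>r \<ge> 0\<close>.\<close>

fun occ :: "('a \<times> real) list \<Rightarrow> 'a \<Rightarrow> real \<Rightarrow> real" where
  "occ [] b r = 0"
| "occ ((a, w) # ws) b r = (if a = b then min r w else 0) + occ ws b (max 0 (r - w))"

text \<open>These are the Eilenberg-Zilber normal forms: distinct neighbours mean a nondegenerate
  simplex of \<open>ESet\<close>, positive weights an interior point of it.\<close>

definition reduced_word :: "('a \<times> real) list \<Rightarrow> bool" where
  "reduced_word ws \<longleftrightarrow> distinct_adj (map fst ws) \<and> (\<forall>p\<in>set ws. 0 < snd p)"

lemma occ_0: "\<forall>p\<in>set ws. 0 \<le> snd p \<Longrightarrow> occ ws b 0 = 0"
  by (induction ws) (auto simp: min_def max_def)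

lemma occ_le: "\<lbrakk>\<forall>p\<in>set ws. 0 \<le> snd p; 0 \<le> r\<rbrakk> \<Longrightarrow> occ ws b r \<le> r"
proof (induction ws arbitrary: r)
  case (Cons p ws)
  obtain a w where p: "p = (a, w)" by force
  show ?case using Cons.IH[of "max 0 (r - w)"] Cons.prems by (auto simp: p)
qed simp

lemma occ_total:
  "\<forall>p\<in>set ws. 0 \<le> snd p \<Longrightarrow>
     occ ws b (sum_list (map snd ws)) = (\<Sum>p\<leftarrow>ws. if fst p = b then snd p else 0)"
proof (induction ws)
  case (Cons p ws)
  obtain a w where p: "p = (a, w)" by force
  have "0 \<le> sum_list (map snd ws)" using Cons.prems by (auto intro!: sum_list_nonneg)
  then show ?case using Cons by (auto simp: p)
qed simp

lemma occ_append_cong: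
  assumes "\<And>r. 0 \<le> r \<Longrightarrow> occ vs b r = occ vs' b r" "0 \<le> r"
  shows "occ (us @ vs) b r = occ (us @ vs') b r"
  using assms(2)
proof (induction us arbitrary: r)
  case (Cons p us)
  then show ?case by (cases p) simp
qed (use assms in simp)

lemma occ_zero: "0 \<le> r \<Longrightarrow> occ (us @ (a, 0) # vs) b r = occ (us @ vs) b r"
  by (rule occ_append_cong) auto

lemma occ_merge:
  assumes "0 \<le> w" "0 \<le> v" "0 \<le> r"
  shows "occ (us @ (a, w) # (a, v) # vs) b r = occ (us @ (a, w + v) # vs) b r"
proof (rule occ_append_cong[OF _ assms(3)])
  fix r :: real assume "0 \<le> r"
  then have "max 0 (max 0 (r - w) - v) = max 0 (r - (w + v))"
    "min r w + min (max 0 (r - w)) v = min r (w + v)"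
    using assms by (auto simp: min_def max_def)
  then show "occ ((a, w) # (a, v) # vs) b r = occ ((a, w + v) # vs) b r"
    by simp
qed

text \<open>Past the first interval a reduced word takes another value at once, so \<open>w\<close>
  is the largest \<open>r\<close> at which \<open>a\<close> has measure \<open>r\<close>.\<close>

lemma occ_head_lt:
  assumes "reduced_word ((a, w) # ws)" "w < r"
  shows "occ ((a, w) # ws) a r < r"
proof (cases ws)
  case Nil
  then show ?thesis using assms by (auto simp: reduced_word_def)
next
  case (Cons p vs)
  obtain c z where p: "p = (c, z)" by force
  have c: "c \<noteq> a" "0 < z" "\<forall>q\<in>set vs. 0 \<le> snd q" using assms(1) Cons p
    by (auto simp: reduced_word_def intro: less_imp_le)
  have "occ vs a (max 0 (r - w - z)) \<le> max 0 (r - w - z)"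
    using c by (intro occ_le) auto
  then show ?thesis using assms c by (simp add: Cons p max_def split: if_splits)
qed

text \<open>The first interval can be read off: its value is the letter with measure
  \<open>r\<close> for all small \<open>r\<close>, and \<open>occ_head_lt\<close> determines its
  length. Removing it shifts the arguments of \<open>occ\<close> by that length, which permits
  induction.\<close>

lemma occ_inject:
  assumes "reduced_word ws" "reduced_word vs" "\<And>b r. 0 \<le> r \<Longrightarrow> occ ws b r = occ vs b r"
  shows "ws = vs"
  using assms
proof (induction ws arbitrary: vs)
  case Nil
  show ?case
  proof (cases vs)
    case (Cons p vs')
    obtain a w where p: "p = (a, w)" by force
    have nn: "\<forall>q\<in>set vs'. 0 \<le> snd q" "0 < w" using Nil Cons p by (auto simp: reduced_word_def intro: less_imp_le)
    then have "occ vs a w = w" by (simp add: Cons p occ_0)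
    then show ?thesis using Nil(3)[of w a] nn by simp
  qed simp
next
  case (Cons p ws)
  obtain a w where p: "p = (a, w)" by force
  have w: "\<forall>q\<in>set ws. 0 \<le> snd q" "0 < w" "reduced_word ws"
    using Cons.prems(1) p by (auto simp: reduced_word_def distinct_adj_Cons intro: less_imp_le)
  have Ea: "occ (p # ws) a w = w" using w by (simp add: p occ_0)
  show ?case
  proof (cases vs)
    case Nil
    then show ?thesis using Cons.prems(3)[of w a] w Ea by simp
  next
    case (Cons q us)
    obtain b v where q: "q = (b, v)" by force
    have v: "\<forall>q\<in>set us. 0 \<le> snd q" "0 < v" "reduced_word us"
      using Cons.prems(2) q Cons by (auto simp: reduced_word_def distinct_adj_Cons intro: less_imp_le)
    have Eb: "occ vs b v = v" using v by (simp add: q Cons occ_0)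
    have eq: "occ (p # ws) c r = occ vs c r" if "0 \<le> r" for c r using Cons.prems(3) that by blast
    \<comment> \<open>On the shorter of the two first intervals one word takes only the value
      \<open>a\<close>, the other only the value \<open>b\<close>.\<close>
    have ab: "a = b"
    proof (rule ccontr)
      assume ne: "a \<noteq> b"
      show False
      proof (cases "w \<le> v")
        case True
        then have "occ vs a w = 0" using ne v by (simp add: q Cons occ_0)
        then show False using eq[of w a] Ea w by simp
      next
        case False
        then have "occ (p # ws) b v = 0" using ne w by (simp add: p occ_0)
        then show False using eq[of v b] Eb v by simp
      qed
    qed
    have "\<not> w < v" using occ_head_lt[of a w ws v] Cons.prems(1) eq[of v a] Eb ab v p by auto
    moreover have "\<not> v < w" using occ_head_lt[of b v us w] Cons.prems(2) eq[of w a] Ea ab w q Cons by auto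
    ultimately have wv: "w = v" by simp
    have "occ ws c r = occ us c r" if "0 \<le> r" for c r
      using eq[of "r + w" c] that w by (simp add: p q Cons ab wv split: if_splits)
    then have "ws = us" using Cons.IH[of us] w v by simp
    then show ?thesis by (simp add: p q Cons ab wv)
  qed
qed

text \<open>The two ways of failing are the two gluings read as reductions: a zero weight is a point
  on a face, equal neighbours form a degenerate simplex.\<close>

lemma not_reduced_cases:
  assumes "\<not> reduced_word ws" "\<forall>p\<in>set ws. 0 \<le> snd p"
  obtains (zero) us a vs where "ws = us @ (a, 0) # vs"
  | (merge) us a w v vs where "ws = us @ (a, w) # (a, v) # vs"
proof (cases "\<forall>p\<in>set ws. 0 < snd p")
  case False
  then obtain a w where "(a, w) \<in> set ws" "w \<le> 0" by auto
  moreover from this have "w = 0" using assms(2) by force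
  ultimately show ?thesis using zero split_list by metis
next
  case True
  then have "\<not> distinct_adj (map fst ws)" using assms by (simp add: reduced_word_def)
  then have "\<exists>us a w v vs. ws = us @ (a, w) # (a, v) # vs"
  proof (induction ws)
    case (Cons p ws)
    show ?case
    proof (cases "distinct_adj (map fst ws)")
      case True
      then obtain q ws' where "ws = q # ws'" "fst q = fst p"
        using Cons.prems by (cases ws) (auto simp: distinct_adj_Cons)
      then have "p # ws = [] @ (fst p, snd p) # (fst p, snd q) # ws'" by (metis append_Nil prod.collapse)
      then show ?thesis by blast
    next
      case False
      then show ?thesis using Cons.IH by (metis append_Cons)
    qed
  qed simp
  then show ?thesis using merge by blast
qed

section \<open>Realizations of vertex complexes\<close>

text \<open>Simplices are selected by their vertex sets, so closure under degeneracies is automatic,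
  and closure under faces follows when \<open>P\<close> is antitone.\<close>

definition vcomplex :: "('a set \<Rightarrow> bool) \<Rightarrow> 'a list sset" where
  "vcomplex P = (ESet UNIV)\<lparr>simplices := \<lambda>n. {xs. length xs = Suc n \<and> P (set xs)}\<rparr>"

lemma translates_eq_vcomplex: "translates K C = vcomplex (\<lambda>A. \<exists>g\<in>K. A \<subseteq> (+) g ` C)"
proof -
  have "{map ((+) g) xs | g xs. g \<in> K \<and> xs \<in> simplices (ESet C) n}
      = {xs. length xs = Suc n \<and> (\<exists>g\<in>K. set xs \<subseteq> (+) g ` C)}" for n
  proof (intro equalityI subsetI)
    fix ys assume "ys \<in> {xs. length xs = Suc n \<and> (\<exists>g\<in>K. set xs \<subseteq> (+) g ` C)}"
    then obtain g where g: "g \<in> K" "length ys = Suc n" "set ys \<subseteq> (+) g ` C" by auto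
    have "ys = map ((+) g) (map (\<lambda>y. - g + y) ys)" by (simp add: comp_def add.assoc[symmetric])
    moreover have "map (\<lambda>y. - g + y) ys \<in> simplices (ESet C) n"
      using g(2,3) by (auto simp: ESet_def add.assoc[symmetric])
    ultimately show "ys \<in> {map ((+) g) xs | g xs. g \<in> K \<and> xs \<in> simplices (ESet C) n}"
      using g(1) by blast
  qed (fastforce simp: ESet_def)
  then show ?thesis by (simp add: translates_def vcomplex_def)
qed

lemma simplices_vcomplex [simp]: "xs \<in> simplices (vcomplex P) n \<longleftrightarrow> length xs = Suc n \<and> P (set xs)"
  and face_vcomplex [simp]: "face (vcomplex P) n i xs = take i xs @ drop (Suc i) xs"
  and degen_vcomplex [simp]: "degen (vcomplex P) n i xs = take (Suc i) xs @ drop i xs"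
  by (simp_all add: vcomplex_def ESet_def)

lemma topspace_simplex_coproduct:
  "((n, x), t) \<in> topspace (simplex_coproduct X) \<longleftrightarrow> x \<in> simplices X n \<and> t \<in> standard_simplex n"
  by (auto simp: simplex_coproduct_def)

section \<open>Points of the coproduct as weighted words\<close>

definition weighted :: "(nat \<times> 'a list) \<times> (nat \<Rightarrow> real) \<Rightarrow> ('a \<times> real) list" where
  "weighted p = zip (snd (fst p)) (map (snd p) [0..<Suc (fst (fst p))])"

text \<open>Recovers a point from its \<open>weighted\<close> word. Coordinates beyond the last
  entry are 0 because \<open>standard_simplex\<close> consists of functions on all natural
  numbers.\<close>

definition point :: "('a \<times> real) list \<Rightarrow> (nat \<times> 'a list) \<times> (nat \<Rightarrow> real)" where
  "point ws = ((length ws - 1, map fst ws), \<lambda>i. if i < length ws then snd (ws ! i) else 0)"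

text \<open>\<open>P\<close> is imposed on all letters, also on those of weight zero, since it has
  to describe the simplex and not only the point in it.\<close>

definition weighted_in :: "('a set \<Rightarrow> bool) \<Rightarrow> ('a \<times> real) list \<Rightarrow> bool" where
  "weighted_in P ws \<longleftrightarrow> ws \<noteq> [] \<and> P (fst ` set ws) \<and> (\<forall>p\<in>set ws. 0 \<le> snd p) \<and> sum_list (map snd ws) = 1"

lemma weighted_in_nonneg: "weighted_in P ws \<Longrightarrow> \<forall>p\<in>set ws. 0 \<le> snd p"
  by (simp add: weighted_in_def)

lemma weighted_nth:
  assumes "length xs = Suc n" "i \<le> n"
  shows "weighted ((n, xs), t) ! i = (xs ! i, t i)"
  using assms by (simp add: weighted_def del: upt_Suc)

lemma length_weighted: "length xs = Suc n \<Longrightarrow> length (weighted ((n, xs), t)) = Suc n"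
  by (simp add: weighted_def del: upt_Suc)

lemma set_weighted: "length xs = Suc n \<Longrightarrow> set (weighted ((n, xs), t)) = {(xs ! i, t i) | i. i \<le> n}"
  by (auto simp: weighted_def set_zip less_Suc_eq_le simp del: upt_Suc) 

lemma weighted_in_weighted:
  assumes "p \<in> topspace (simplex_coproduct (vcomplex P))"
  shows "weighted_in P (weighted p)"
proof -
  obtain n xs t where p: "p = ((n, xs), t)" by (metis prod.collapse)
  have xs: "length xs = Suc n" "P (set xs)" and t: "t \<in> standard_simplex n"
    using assms by (auto simp: p topspace_simplex_coproduct)
  have "map fst (weighted ((n, xs), t)) = xs" "map snd (weighted ((n, xs), t)) = map t [0..<Suc n]"
    using xs(1) by (simp_all add: weighted_def del: upt_Suc)
  moreover have "sum_list (map t [0..<Suc n]) = (\<Sum>i\<le>n. t i)"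
    by (simp add: interv_sum_list_conv_sum_set_nat atLeast0LessThan lessThan_Suc_atMost del: upt_Suc)
  ultimately show ?thesis
    using xs t length_weighted[OF xs(1), of t] set_weighted[OF xs(1), of t]
    unfolding weighted_in_def set_map[symmetric]
    by (auto simp: p standard_simplex_def simp del: upt_Suc set_map)
qed

lemma point_weighted:
  assumes "p \<in> topspace (simplex_coproduct (vcomplex P))"
  shows "point (weighted p) = p"
proof -
  obtain n xs t where p: "p = ((n, xs), t)" by (metis prod.collapse)
  have xs: "length xs = Suc n" and t: "\<forall>i>n. t i = 0"
    using assms by (auto simp: p topspace_simplex_coproduct standard_simplex_def)
  have "map fst (weighted ((n, xs), t)) = xs" using xs by (simp add: weighted_def del: upt_Suc)
  then show ?thesis using t by (auto simp: p point_def length_weighted[OF xs] weighted_nth[OF xs])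
qed

lemma point_in_topspace:
  assumes "weighted_in P ws"
  shows "point ws \<in> topspace (simplex_coproduct (vcomplex P))"
proof -
  let ?t = "\<lambda>i. if i < length ws then snd (ws ! i) else 0"
  have "(\<Sum>i\<le>length ws - 1. ?t i) = (\<Sum>i<length ws. ?t i)"
    using assms by (intro sum.cong) (cases ws; auto simp: weighted_in_def less_Suc_eq_le)+
  also have "\<dots> = sum_list (map snd ws)"
    by (simp add: sum_list_sum_nth atLeast0LessThan)
  finally have s: "(\<Sum>i\<le>length ws - 1. ?t i) = 1" using assms by (simp add: weighted_in_def)
  have nn: "0 \<le> ?t i" for i using assms by (auto simp: weighted_in_def)
  have "?t i \<le> 1" for i
  proof (cases "i \<le> length ws - 1")
    case True
    then have "?t i \<le> (\<Sum>i\<le>length ws - 1. ?t i)" by (intro member_le_sum nn) auto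
    then show ?thesis using s by simp
  qed (use assms in \<open>auto simp: weighted_in_def\<close>)
  then have "?t \<in> standard_simplex (length ws - 1)"
    using s nn assms by (auto simp: standard_simplex_def weighted_in_def)
  then show ?thesis using assms by (auto simp: point_def topspace_simplex_coproduct weighted_in_def)
qed

lemma diff_eq_Suc: "m - n = Suc k \<Longrightarrow> m = Suc (n + k)"
  by simp

lemma glue_point_zero:
  assumes "weighted_in P (us @ (a, 0) # vs)"
  shows "glue (vcomplex P) (point (us @ vs)) (point (us @ (a, 0) # vs))"
proof -
  let ?n = "length (us @ vs) - 1"
  have ne: "us @ vs \<noteq> []" using assms by (auto simp: weighted_in_def)
  then have n: "length (us @ vs) = Suc ?n" by (cases "us @ vs") auto
  have "simplical_face (length us) (snd (point (us @ vs))) = snd (point (us @ (a, 0) # vs))"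
    by (auto simp: fun_eq_iff simplical_face_def point_def nth_append nth_Cons
      dest: diff_eq_Suc split: nat.splits)
  \<comment> \<open>The trivial predicate isolates the condition on the coordinates of the shorter
    word.\<close>
  moreover have "weighted_in (\<lambda>_. True) (us @ vs)"
    using assms ne by (auto simp: weighted_in_def)
  from point_in_topspace[OF this] have "snd (point (us @ vs)) \<in> standard_simplex ?n"
    by (simp add: point_def topspace_simplex_coproduct)
  moreover have "map fst (us @ (a, 0) # vs) \<in> simplices (vcomplex P) (Suc ?n)"
    using assms n by (simp add: weighted_in_def image_Un)
  ultimately show ?thesis
    using glue.face[of "map fst (us @ (a, 0) # vs)" "vcomplex P" ?n "length us" "snd (point (us @ vs))"] n
    by (simp add: point_def)
qed

lemma glue_point_merge:
  assumes "weighted_in P (us @ (a, w) # (a, v) # vs)"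
  shows "glue (vcomplex P) (point (us @ (a, w) # (a, v) # vs)) (point (us @ (a, w + v) # vs))"
proof -
  let ?n = "length us + length vs"
  let ?t = "snd (point (us @ (a, w) # (a, v) # vs))"
  have "simplicial_degen (length us) ?t j = snd (point (us @ (a, w + v) # vs)) j" for j
  proof (cases "j \<le> length us")
    case True
    then show ?thesis by (cases "j = length us") (auto simp: simplicial_degen_def point_def nth_append)
  next
    case False
    then obtain k where "j = Suc (length us + k)" using less_natE by (metis not_le)
    then show ?thesis by (simp add: simplicial_degen_def point_def nth_append)
  qed
  then have "simplicial_degen (length us) ?t = snd (point (us @ (a, w + v) # vs))" by blast
  moreover have "?t \<in> standard_simplex (Suc ?n)"
    using point_in_topspace[OF assms] by (simp add: point_def topspace_simplex_coproduct)
  moreover have "map fst (us @ (a, w + v) # vs) \<in> simplices (vcomplex P) ?n"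
    using assms by (simp add: weighted_in_def image_Un)
  ultimately show ?thesis
    using glue.degen[of "map fst (us @ (a, w + v) # vs)" "vcomplex P" ?n "length us" ?t]
    by (simp add: point_def)
qed

text \<open>Each reduction shortens the word, is a gluing and leaves \<open>occ\<close> unchanged.
  Antitonicity keeps the word inside the complex when a letter is dropped.\<close>

lemma reduce_weighted:
  assumes "antimono P" "weighted_in P ws"
  obtains vs where "weighted_in P vs" "reduced_word vs" "equivclp (glue (vcomplex P)) (point ws) (point vs)"
    "\<And>b r. 0 \<le> r \<Longrightarrow> occ ws b r = occ vs b r"
  using assms(2)
proof (induction "length ws" arbitrary: ws thesis rule: less_induct)
  case less
  show ?case
  proof (cases "reduced_word ws")
    case True
    then show ?thesis using less(2)[of ws] less.prems by (auto simp: equivp_reflp[OF equivp_evquivclp])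
  next
    case False
    have "\<exists>ws'. weighted_in P ws' \<and> length ws' < length ws \<and> equivclp (glue (vcomplex P)) (point ws) (point ws')
      \<and> (\<forall>b r. 0 \<le> r \<longrightarrow> occ ws b r = occ ws' b r)"
      using False weighted_in_nonneg[OF less.prems(2)]
    proof (cases rule: not_reduced_cases)
      case (zero us a vs)
      have "P (fst ` set (us @ vs))"
        using antimonoD[OF assms(1), of "fst ` set (us @ vs)" "fst ` set ws"] less.prems(2)
        by (auto simp: weighted_in_def zero)
      then have "weighted_in P (us @ vs)" using less.prems(2) zero by (auto simp: weighted_in_def)
      moreover have "equivclp (glue (vcomplex P)) (point ws) (point (us @ vs))"
        using converse_r_into_equivclp[of "glue (vcomplex P)", OF glue_point_zero[of P us a vs]] less.prems(2)
        by (simp add: zero)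
      moreover have "\<forall>b r. 0 \<le> r \<longrightarrow> occ ws b r = occ (us @ vs) b r"
        by (simp add: zero occ_zero)
      ultimately show ?thesis using zero by (intro exI[of _ "us @ vs"]) auto
    next
      case (merge us a w v vs)
      have "weighted_in P (us @ (a, w + v) # vs)" using less.prems(2) merge by (auto simp: weighted_in_def)
      moreover have "equivclp (glue (vcomplex P)) (point ws) (point (us @ (a, w + v) # vs))"
        using r_into_equivclp[of "glue (vcomplex P)", OF glue_point_merge[of P us a w v vs]] less.prems(2)
        by (simp add: merge)
      moreover have "\<forall>b r. 0 \<le> r \<longrightarrow> occ ws b r = occ (us @ (a, w + v) # vs) b r"
        using less.prems(2) by (auto simp: merge weighted_in_def intro!: occ_merge)
      ultimately show ?thesis using merge by (intro exI[of _ "us @ (a, w + v) # vs"]) auto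
    qed
    then obtain ws' where ws': "weighted_in P ws'" "length ws' < length ws"
      "equivclp (glue (vcomplex P)) (point ws) (point ws')" "\<And>b r. 0 \<le> r \<Longrightarrow> occ ws b r = occ ws' b r"
      by blast
    obtain vs where vs: "weighted_in P vs" "reduced_word vs" "equivclp (glue (vcomplex P)) (point ws') (point vs)"
      "\<And>b r. 0 \<le> r \<Longrightarrow> occ ws' b r = occ vs b r"
      using less.hyps[OF ws'(2) _ ws'(1)] by blast
    show ?thesis
      using less.prems(1)[OF vs(1,2)] equivp_transp[OF equivp_evquivclp ws'(3) vs(3)] ws'(4) vs(4) by simp
  qed
qed

section \<open>Equality of points of a realization\<close>

lemma occ_glue:
  assumes "glue (vcomplex P) p q" "0 \<le> r"
  shows "occ (weighted p) b r = occ (weighted q) b r"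
  using assms(1)
proof cases
  case (face xs n i t)
  let ?W = "weighted ((Suc n, xs), simplical_face i t)"
  have len: "length xs = Suc (Suc n)" using face by simp
  have "weighted p = take i ?W @ drop (Suc i) ?W"
    using face len by (intro nth_equalityI)
      (auto simp: length_weighted weighted_nth nth_append simplical_face_def)
  moreover have "?W = take i ?W @ (xs ! i, 0) # drop (Suc i) ?W"
    using id_take_nth_drop[of i ?W] face len by (simp add: length_weighted weighted_nth simplical_face_def)
  ultimately show ?thesis using occ_zero[OF assms(2)] face by metis
next
  case (degen xs n i t)
  let ?W = "weighted p"
  have len: "length xs = Suc n" and t: "0 \<le> t i" "0 \<le> t (Suc i)" using degen by (auto simp: standard_simplex_def)
  have p: "p = ((Suc n, take (Suc i) xs @ drop i xs), t)" using degen by simp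
  have l2: "length (take (Suc i) xs @ drop i xs) = Suc (Suc n)" using len degen by simp
  have "?W = take i ?W @ (xs ! i, t i) # (xs ! i, t (Suc i)) # drop (Suc (Suc i)) ?W"
    using id_take_nth_drop[of i ?W] Cons_nth_drop_Suc[of "Suc i" ?W] degen len
    by (simp add: p length_weighted[OF l2] weighted_nth[OF l2] nth_append)
  moreover have "weighted q = take i ?W @ (xs ! i, t i + t (Suc i)) # drop (Suc (Suc i)) ?W"
    using degen len l2
    by (intro nth_equalityI)
      (auto simp: p length_weighted weighted_nth nth_append nth_Cons simplicial_degen_def min_def
         length_weighted[OF l2] weighted_nth[OF l2] dest: diff_eq_Suc split: nat.splits)
  ultimately show ?thesis using occ_merge[OF t assms(2)] by metis
qed

lemma occ_equivclp:
  assumes "equivclp (glue (vcomplex P)) p q" "0 \<le> r"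
  shows "occ (weighted p) b r = occ (weighted q) b r"
  using assms(1) by (induction rule: equivclp_induct) (auto elim!: symclpE simp: occ_glue[OF _ assms(2)])

text \<open>A face inclusion inserts an interval of length zero and a degeneracy splits an interval
  in two, so gluing preserves \<open>occ\<close>. Conversely, both points are glued to reduced
  words, which \<open>occ_inject\<close> identifies.\<close>

lemma realization_rel_iff:
  assumes "antimono P" "p \<in> topspace (simplex_coproduct (vcomplex P))" "q \<in> topspace (simplex_coproduct (vcomplex P))"
  shows "(p, q) \<in> realization_rel (vcomplex P) \<longleftrightarrow> (\<forall>b. \<forall>r\<ge>0. occ (weighted p) b r = occ (weighted q) b r)"
proof
  assume eq: "\<forall>b. \<forall>r\<ge>0. occ (weighted p) b r = occ (weighted q) b r"
  have W: "weighted_in P (weighted p)" "weighted_in P (weighted q)" "point (weighted p) = p" "point (weighted q) = q"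
    using assms(2,3) by (simp_all add: weighted_in_weighted point_weighted)
  obtain ps where ps: "weighted_in P ps" "reduced_word ps" "equivclp (glue (vcomplex P)) (point (weighted p)) (point ps)"
    "\<And>b r. 0 \<le> r \<Longrightarrow> occ (weighted p) b r = occ ps b r"
    by (rule reduce_weighted[OF assms(1) W(1)]) (rule that)
  obtain qs where qs: "weighted_in P qs" "reduced_word qs" "equivclp (glue (vcomplex P)) (point (weighted q)) (point qs)"
    "\<And>b r. 0 \<le> r \<Longrightarrow> occ (weighted q) b r = occ qs b r"
    by (rule reduce_weighted[OF assms(1) W(2)]) (rule that)
  have "ps = qs" using occ_inject[OF ps(2) qs(2)] ps(4) qs(4) eq by simp
  moreover have "equivclp (glue (vcomplex P)) p (point ps)" "equivclp (glue (vcomplex P)) q (point qs)"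
    using ps(3) qs(3) by (simp_all add: W)
  ultimately have "equivclp (glue (vcomplex P)) p q"
    using equivp_transp[OF equivp_evquivclp] equivp_symp[OF equivp_evquivclp] by metis
  then show "(p, q) \<in> realization_rel (vcomplex P)" using assms by (simp add: realization_rel_def)
next
  assume "(p, q) \<in> realization_rel (vcomplex P)"
  then show "\<forall>b. \<forall>r\<ge>0. occ (weighted p) b r = occ (weighted q) b r"
    by (auto simp: realization_rel_def intro: occ_equivclp)
qed

section \<open>The quotient topology\<close>

definition rcls :: "'a sset \<Rightarrow> (nat \<times> 'a) \<times> (nat \<Rightarrow> real) \<Rightarrow> ((nat \<times> 'a) \<times> (nat \<Rightarrow> real)) set" where
  "rcls X p = realization_rel X `` {p}"

lemma topspace_realization: "topspace (realization X) = rcls X ` topspace (simplex_coproduct X)"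
  by (auto simp: realization_def topspace_quotient_topology[OF equiv_realization_rel] quotient_def rcls_def)

lemma rcls_eq_iff:
  assumes "p \<in> topspace (simplex_coproduct X)" "q \<in> topspace (simplex_coproduct X)"
  shows "rcls X p = rcls X q \<longleftrightarrow> (p, q) \<in> realization_rel X"
  unfolding rcls_def using eq_equiv_class_iff[OF equiv_realization_rel assms] .

lemma quotient_map_rcls: "quotient_map (simplex_coproduct X) (realization X) (rcls X)"
  unfolding quotient_map_def
proof (intro conjI allI impI)
  show "rcls X ` topspace (simplex_coproduct X) = topspace (realization X)"
    by (simp add: topspace_realization)
  fix U assume U: "U \<subseteq> topspace (realization X)"
  then have U': "U \<subseteq> topspace (simplex_coproduct X) // realization_rel X"
    by (simp add: realization_def topspace_quotient_topology[OF equiv_realization_rel])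
  have "{p \<in> topspace (simplex_coproduct X). rcls X p \<in> U} = \<Union>U"
  proof (intro equalityI subsetI)
    fix p assume "p \<in> {p \<in> topspace (simplex_coproduct X). rcls X p \<in> U}"
    then show "p \<in> \<Union>U" unfolding rcls_def using equiv_class_self[OF equiv_realization_rel] by blast
  next
    fix p assume "p \<in> \<Union>U"
    then obtain c where c: "c \<in> U" "p \<in> c" by blast
    then have "p \<in> topspace (simplex_coproduct X)"
      using U' Union_quotient[OF equiv_realization_rel] by blast
    moreover obtain q where "c = realization_rel X `` {q}" using c(1) U' by (auto simp: quotient_def)
    then have "c = rcls X p" using c(2) equiv_class_eq[OF equiv_realization_rel, of q p] by (simp add: rcls_def)
    ultimately show "p \<in> {p \<in> topspace (simplex_coproduct X). rcls X p \<in> U}" using c by blast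
  qed
  then show "openin (simplex_coproduct X) {p \<in> topspace (simplex_coproduct X). rcls X p \<in> U} = openin (realization X) U"
    using U' by (simp add: realization_def openin_quotient_topology[OF equiv_realization_rel])
qed

text \<open>The topology is the weak one, a quotient of a coproduct, so closedness can be tested on
  one simplex at a time.\<close>

lemma closedin_realization:
  "closedin (realization X) S \<longleftrightarrow> S \<subseteq> topspace (realization X) \<and>
     (\<forall>n. \<forall>x\<in>simplices X n. closedin (subtopology (powertop_real UNIV) (standard_simplex n))
        {t \<in> standard_simplex n. rcls X ((n, x), t) \<in> S})"
proof -
  have "{t. ((n, x), t) \<in> {p \<in> topspace (simplex_coproduct X). rcls X p \<in> S}}
      = {t \<in> standard_simplex n. rcls X ((n, x), t) \<in> S}" if "x \<in> simplices X n" for n x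
    using that by (auto simp: topspace_simplex_coproduct)
  moreover have "{p \<in> topspace (simplex_coproduct X). rcls X p \<in> S}
      \<subseteq> Sigma (SIGMA n:UNIV. simplices X n) (\<lambda>(n, x). standard_simplex n)"
    by (auto simp: topspace_simplex_coproduct)
  ultimately have slices: "closedin (simplex_coproduct X) {p \<in> topspace (simplex_coproduct X). rcls X p \<in> S} \<longleftrightarrow>
     (\<forall>n. \<forall>x\<in>simplices X n. closedin (subtopology (powertop_real UNIV) (standard_simplex n))
        {t \<in> standard_simplex n. rcls X ((n, x), t) \<in> S})"
    unfolding simplex_coproduct_def closedin_sum_topology by (auto simp: comp_def case_prod_unfold)
  show ?thesis
  proof (cases "S \<subseteq> topspace (realization X)")
    case True
    then have "closedin (realization X) S
        \<longleftrightarrow> closedin (simplex_coproduct X) {p \<in> topspace (simplex_coproduct X). rcls X p \<in> S}"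
      using quotient_map_rcls[of X] by (simp add: quotient_map_closedin)
    then show ?thesis using True by (simp only: slices simp_thms)
  next
    case False
    then show ?thesis using closedin_subset by blast
  qed
qed

subsection \<open>Induced maps\<close>

definition relabel :: "('a \<Rightarrow> 'b) \<Rightarrow> (nat \<times> 'a list) \<times> (nat \<Rightarrow> real) \<Rightarrow> (nat \<times> 'b list) \<times> (nat \<Rightarrow> real)" where
  "relabel \<phi> p = ((fst (fst p), map \<phi> (snd (fst p))), snd p)"

text \<open>Saturating the relabelled class, instead of choosing a representative, makes
  \<open>realization_incl\<close> literally the case of the identity.\<close>

definition vmap :: "('a \<Rightarrow> 'b) \<Rightarrow> ('b set \<Rightarrow> bool) \<Rightarrow> ((nat \<times> 'a list) \<times> (nat \<Rightarrow> real)) set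
    \<Rightarrow> ((nat \<times> 'b list) \<times> (nat \<Rightarrow> real)) set" where
  "vmap \<phi> Q c = realization_rel (vcomplex Q) `` (relabel \<phi> ` c)"

definition vertex_map :: "('a \<Rightarrow> 'b) \<Rightarrow> ('a set \<Rightarrow> bool) \<Rightarrow> ('b set \<Rightarrow> bool) \<Rightarrow> bool" where
  "vertex_map \<phi> P Q \<longleftrightarrow> (\<forall>A. P A \<longrightarrow> Q (\<phi> ` A))"

lemma vertex_mapD: "vertex_map \<phi> P Q \<Longrightarrow> P A \<Longrightarrow> Q (\<phi> ` A)"
  by (simp add: vertex_map_def)

lemma realization_incl_vcomplex: "realization_incl (vcomplex Q) = vmap (\<lambda>x. x) Q"
  by (simp add: fun_eq_iff realization_incl_def vmap_def relabel_def)

lemma relabel_in_topspace: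
  assumes "vertex_map \<phi> P Q" "p \<in> topspace (simplex_coproduct (vcomplex P))"
  shows "relabel \<phi> p \<in> topspace (simplex_coproduct (vcomplex Q))"
  using assms by (cases p) (auto simp: relabel_def topspace_simplex_coproduct vertex_map_def)

lemma glue_relabel:
  assumes "vertex_map \<phi> P Q" "glue (vcomplex P) p q"
  shows "glue (vcomplex Q) (relabel \<phi> p) (relabel \<phi> q)"
  using assms(2)
proof cases
  case (face x n i t)
  then show ?thesis using glue.face[of "map \<phi> x" "vcomplex Q" n i t] assms(1)
    by (simp add: vertex_map_def relabel_def take_map drop_map)
next
  case (degen x n i t)
  then show ?thesis using glue.degen[of "map \<phi> x" "vcomplex Q" n i t] assms(1)
    by (simp add: vertex_map_def relabel_def take_map drop_map)
qed

lemma realization_rel_relabel: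
  assumes "vertex_map \<phi> P Q" "(p, q) \<in> realization_rel (vcomplex P)"
  shows "(relabel \<phi> p, relabel \<phi> q) \<in> realization_rel (vcomplex Q)"
proof -
  have "equivclp (glue (vcomplex P)) p q" using assms(2) by (simp add: realization_rel_def)
  then have "equivclp (glue (vcomplex Q)) (relabel \<phi> p) (relabel \<phi> q)"
  proof (induction rule: equivclp_induct)
    case base
    show ?case by (simp add: equivp_reflp[OF equivp_evquivclp])
  next
    case (step y z)
    have "equivclp (glue (vcomplex Q)) (relabel \<phi> y) (relabel \<phi> z)"
      using step(2)
    proof
      assume "glue (vcomplex P) y z"
      from r_into_equivclp[of "glue (vcomplex Q)", OF glue_relabel[OF assms(1) this]]
      show ?thesis by blast
    next
      assume "glue (vcomplex P) z y"
      from converse_r_into_equivclp[of "glue (vcomplex Q)", OF glue_relabel[OF assms(1) this]]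
      show ?thesis by blast
    qed
    with step(3) show ?case by (rule equivp_transp[OF equivp_evquivclp])
  qed
  then show ?thesis using assms relabel_in_topspace[OF assms(1)] by (auto simp: realization_rel_def)
qed

lemma vmap_rcls:
  assumes "vertex_map \<phi> P Q" "p \<in> topspace (simplex_coproduct (vcomplex P))"
  shows "vmap \<phi> Q (rcls (vcomplex P) p) = rcls (vcomplex Q) (relabel \<phi> p)"
proof (intro equalityI subsetI)
  fix q assume "q \<in> rcls (vcomplex Q) (relabel \<phi> p)"
  moreover have "p \<in> rcls (vcomplex P) p"
    unfolding rcls_def using equiv_class_self[OF equiv_realization_rel assms(2)] .
  ultimately show "q \<in> vmap \<phi> Q (rcls (vcomplex P) p)" by (auto simp: vmap_def rcls_def)
next
  fix q assume "q \<in> vmap \<phi> Q (rcls (vcomplex P) p)"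
  then obtain p' where p': "(p, p') \<in> realization_rel (vcomplex P)"
    "(relabel \<phi> p', q) \<in> realization_rel (vcomplex Q)" by (auto simp: vmap_def rcls_def)
  from realization_rel_relabel[OF assms(1) p'(1)] p'(2)
  show "q \<in> rcls (vcomplex Q) (relabel \<phi> p)"
    unfolding rcls_def using equiv_realization_rel[of "vcomplex Q"] by (auto elim!: equivE dest: transD)
qed

lemma continuous_map_vmap:
  assumes "vertex_map \<phi> P Q"
  shows "continuous_map (realization (vcomplex P)) (realization (vcomplex Q)) (vmap \<phi> Q)"
proof (rule continuous_compose_quotient_map[OF quotient_map_rcls])
  let ?X = "simplex_coproduct (vcomplex P)" and ?Y = "simplex_coproduct (vcomplex Q)"
  have "continuous_map ?X ?Y (relabel \<phi>)"
    unfolding continuous_map_def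
  proof (intro conjI allI impI)
    show "relabel \<phi> \<in> topspace ?X \<rightarrow> topspace ?Y" using relabel_in_topspace[OF assms] by blast
    fix U assume U: "openin ?Y U"
    have "openin (subtopology (powertop_real UNIV) (standard_simplex n))
       {t. ((n, xs), t) \<in> {p \<in> topspace ?X. relabel \<phi> p \<in> U}}" if "length xs = Suc n" "P (set xs)" for n xs
    proof -
      have "{t. ((n, xs), t) \<in> {p \<in> topspace ?X. relabel \<phi> p \<in> U}} = {t. ((n, map \<phi> xs), t) \<in> U}"
        using that openin_subset[OF U] assms by (auto simp: vertex_map_def topspace_simplex_coproduct relabel_def)
      moreover have "map \<phi> xs \<in> simplices (vcomplex Q) n" using that assms by (simp add: vertex_map_def)
      then have "openin (subtopology (powertop_real UNIV) (standard_simplex n)) {t. ((n, map \<phi> xs), t) \<in> U}"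
        using U unfolding simplex_coproduct_def openin_sum_topology by fastforce
      ultimately show ?thesis by simp
    qed
    then show "openin ?X {p \<in> topspace ?X. relabel \<phi> p \<in> U}"
      by (subst simplex_coproduct_def) (auto simp: openin_sum_topology topspace_simplex_coproduct)
  qed
  then have "continuous_map ?X (realization (vcomplex Q)) (rcls (vcomplex Q) \<circ> relabel \<phi>)"
    using quotient_imp_continuous_map[OF quotient_map_rcls] by (rule continuous_map_compose)
  then show "continuous_map ?X (realization (vcomplex Q)) (vmap \<phi> Q \<circ> rcls (vcomplex P))"
    by (rule continuous_map_eq) (simp add: vmap_rcls[OF assms])
qed

lemma vmap_vmap:
  assumes "vertex_map \<phi> P Q" "vertex_map \<psi> Q R" "c \<in> topspace (realization (vcomplex P))"
  shows "vmap \<psi> R (vmap \<phi> Q c) = vmap (\<lambda>x. \<psi> (\<phi> x)) R c"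
proof -
  obtain p where p: "c = rcls (vcomplex P) p" "p \<in> topspace (simplex_coproduct (vcomplex P))"
    using assms(3) by (auto simp: topspace_realization)
  have PR: "vertex_map (\<lambda>x. \<psi> (\<phi> x)) P R"
    using assms(1,2) by (force simp: vertex_map_def image_image[symmetric])
  have "relabel \<psi> (relabel \<phi> p) = relabel (\<lambda>x. \<psi> (\<phi> x)) p" by (simp add: relabel_def)
  then show ?thesis
    using vmap_rcls[OF assms(1) p(2)]
      vmap_rcls[OF assms(2) relabel_in_topspace[OF assms(1) p(2)]]
      vmap_rcls[OF PR p(2)] by (simp add: p(1))
qed

abbreviation vertex_point :: "'a \<Rightarrow> (nat \<times> 'a list) \<times> (nat \<Rightarrow> real)" where
  "vertex_point x \<equiv> ((0, [x]), \<lambda>i. if i = 0 then 1 else 0)"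

lemma vertex_point_in_topspace: "P {x} \<Longrightarrow> vertex_point x \<in> topspace (simplex_coproduct (vcomplex P))"
  by (simp add: topspace_simplex_coproduct)

lemma realization_vertex_eq: "realization_vertex (vcomplex P) [x] = rcls (vcomplex P) (vertex_point x)"
  by (simp add: realization_vertex_def rcls_def)

lemma realization_vertex_in_topspace:
  "P {x} \<Longrightarrow> realization_vertex (vcomplex P) [x] \<in> topspace (realization (vcomplex P))"
  using vertex_point_in_topspace[of P x] by (auto simp: realization_vertex_eq topspace_realization)

lemma vmap_vertex:
  assumes "vertex_map \<phi> P Q" "P {x}"
  shows "vmap \<phi> Q (realization_vertex (vcomplex P) [x]) = realization_vertex (vcomplex Q) [\<phi> x]"
  using vmap_rcls[OF assms(1) vertex_point_in_topspace[of P x]] assms(2)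
  by (simp add: realization_vertex_eq relabel_def)

subsection \<open>Closed embeddings\<close>

text \<open>The argument \<open>r\<close> has to vary with the point, since the recursion replaces
  it by \<open>max 0 (r - w)\<close> with \<open>w\<close> a coordinate of the point.\<close>

lemma continuous_map_occ:
  assumes "\<And>i. i \<in> set js \<Longrightarrow> continuous_map X euclideanreal (c i)" "continuous_map X euclideanreal r"
  shows "continuous_map X euclideanreal (\<lambda>z. occ (zip xs (map (\<lambda>i. c i z) js)) b (r z))"
  using assms
proof (induction xs arbitrary: js r)
  case (Cons x xs)
  show ?case
  proof (cases js)
    case (Cons j js')
    have "continuous_map X euclideanreal (\<lambda>z. occ (zip xs (map (\<lambda>i. c i z) js')) b (max 0 (r z - c j z)))"
      using Cons.prems Cons by (intro Cons.IH continuous_map_real_max continuous_map_diff) auto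
    moreover have "continuous_map X euclideanreal (\<lambda>z. if x = b then min (r z) (c j z) else 0)"
      using Cons.prems Cons by (auto intro!: continuous_map_real_min)
    ultimately show ?thesis by (simp add: Cons continuous_map_add)
  qed simp
qed simp

text \<open>Equality of classes amounts to one equation between values of \<open>occ\<close> for
  each \<open>b\<close> and \<open>r\<close>, and each equation is closed by continuity. Over all
  simplices together this says that points are closed.\<close>

lemma closedin_rcls_eq:
  assumes "antimono P" "length xs = Suc n" "P (set xs)" "p \<in> topspace (simplex_coproduct (vcomplex P))"
  shows "closedin (subtopology (powertop_real UNIV) (standard_simplex n))
           {t \<in> standard_simplex n. rcls (vcomplex P) ((n, xs), t) = rcls (vcomplex P) p}"
proof -
  let ?X = "subtopology (powertop_real UNIV) (standard_simplex n)"
  let ?S = "\<lambda>(b, r). {t \<in> topspace ?X. occ (weighted ((n, xs), t)) b r \<in> {occ (weighted p) b r}}"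
  have "continuous_map ?X euclideanreal (\<lambda>t. occ (weighted ((n, xs), t)) b r)" for b r
    unfolding weighted_def fst_conv snd_conv
    by (intro continuous_map_occ continuous_map_from_subtopology continuous_map_product_projection) auto
  then have "closedin ?X {t \<in> topspace ?X. occ (weighted ((n, xs), t)) b r \<in> {occ (weighted p) b r}}" for b r
    by (rule closedin_continuous_map_preimage) simp
  then have "closedin ?X (?S z)" for z by (cases z) simp
  then have "closedin ?X (\<Inter>z\<in>UNIV \<times> {0..}. ?S z)"
    by (intro closedin_INT) auto
  moreover have rcls: "rcls (vcomplex P) ((n, xs), t) = rcls (vcomplex P) p \<longleftrightarrow>
      (\<forall>b. \<forall>r\<ge>0. occ (weighted ((n, xs), t)) b r = occ (weighted p) b r)" if "t \<in> standard_simplex n" for t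
  proof -
    have "((n, xs), t) \<in> topspace (simplex_coproduct (vcomplex P))"
      using that assms by (simp add: topspace_simplex_coproduct)
    then show ?thesis using rcls_eq_iff realization_rel_iff[OF assms(1)] assms(4) by metis
  qed
  have "{t \<in> standard_simplex n. rcls (vcomplex P) ((n, xs), t) = rcls (vcomplex P) p}
      = (\<Inter>z\<in>UNIV \<times> {0..}. ?S z)"
  proof (intro equalityI subsetI)
    fix t assume t: "t \<in> (\<Inter>z\<in>UNIV \<times> {0..}. ?S z)"
    \<comment> \<open>The index set is nonempty, and any one member confines \<open>t\<close> to the
      simplex.\<close>
    then have "t \<in> ?S (undefined, 0)" by blast
    then have "t \<in> standard_simplex n" by simp
    then show "t \<in> {t \<in> standard_simplex n. rcls (vcomplex P) ((n, xs), t) = rcls (vcomplex P) p}"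
      using t rcls by auto
  qed (use rcls in auto)
  ultimately show ?thesis by simp
qed

text \<open>The vertex set of the carrier of a point. Unlike the set of all entries of the word, it
  depends only on the class of the point.\<close>

definition letters :: "('a \<times> real) list \<Rightarrow> 'a set" where
  "letters ws = {a. \<exists>w. (a, w) \<in> set ws \<and> 0 < w}"

text \<open>In a word of total weight one, \<open>occ\<close> at 1 is the total weight of a letter,
  which is nonzero exactly for the letters of positive weight.\<close>

lemma letters_cong:
  assumes "weighted_in P ws" "weighted_in Q vs" "\<And>b. occ ws b 1 = occ vs b 1"
  shows "letters ws = letters vs"
proof -
  have iff: "a \<in> letters us \<longleftrightarrow> occ us a 1 \<noteq> 0" if "weighted_in R us" for R us and a :: 'a
  proof -
    have nn: "\<forall>p\<in>set us. 0 \<le> snd p" and 1: "sum_list (map snd us) = 1" using that by (auto simp: weighted_in_def)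
    have "occ us a 1 = 0 \<longleftrightarrow> (\<forall>p\<in>set us. (if fst p = a then snd p else 0) = 0)"
      unfolding occ_total[OF nn, of a, unfolded 1] using nn by (subst sum_list_nonneg_eq_0_iff) auto
    moreover have "0 < w \<longleftrightarrow> w \<noteq> 0" if "(a, w) \<in> set us" for w using nn that by force
    then have "a \<in> letters us \<longleftrightarrow> \<not> (\<forall>p\<in>set us. (if fst p = a then snd p else 0) = 0)"
      by (fastforce simp: letters_def)
    ultimately show ?thesis by blast
  qed
  show ?thesis by (simp add: set_eq_iff iff[OF assms(1)] iff[OF assms(2)] assms(3))
qed

lemma letters_weighted:
  "length xs = Suc n \<Longrightarrow> letters (weighted ((n, xs), t)) = (!) xs ` {i. i \<le> n \<and> 0 < t i}"
  by (auto simp: letters_def set_weighted)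

lemma letters_subset: "letters ws \<subseteq> fst ` set ws"
  by (force simp: letters_def)

lemma occ_zip_cong:
  assumes "length xs = length ys" "length xs = length ts" "\<And>i. i < length xs \<Longrightarrow> ts ! i \<noteq> 0 \<Longrightarrow> xs ! i = ys ! i" "0 \<le> r"
    "\<forall>t\<in>set ts. 0 \<le> t"
  shows "occ (zip xs ts) b r = occ (zip ys ts) b r"
  using assms
proof (induction xs ys arbitrary: ts r rule: list_induct2)
  case (Cons x xs y ys)
  then obtain t ts' where ts: "ts = t # ts'" by (cases ts) auto
  have "occ (zip xs ts') b (max 0 (r - t)) = occ (zip ys ts') b (max 0 (r - t))"
    using Cons.prems(2)[of "Suc _"] Cons.prems ts by (intro Cons.IH) auto
  moreover have "t \<noteq> 0 \<Longrightarrow> x = y" using Cons.prems(2)[of 0] ts by simp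
  ultimately show ?case using Cons.prems ts by (cases "t = 0") auto
qed simp

text \<open>A simplex of the larger complex need not lie in the smaller one, but a point of it comes
  from there as soon as the vertices of its carrier satisfy \<open>P\<close>. So the trace of the
  image of \<open>F\<close> on a simplex is a finite union over faces \<open>J\<close>, each piece
  being closed because \<open>F\<close> is closed in the smaller realization.\<close>

lemma closed_map_incl:
  assumes P: "antimono P" and Q: "antimono Q" and PQ: "\<And>A. P A \<Longrightarrow> Q A"
  shows "closed_map (realization (vcomplex P)) (realization (vcomplex Q)) (vmap (\<lambda>x. x) Q)"
  unfolding closed_map_def
proof (intro allI impI)
  fix F assume F: "closedin (realization (vcomplex P)) F"
  let ?\<iota> = "vmap (\<lambda>x. x) Q"
  have id: "relabel (\<lambda>x. x) p = p" for p :: "(nat \<times> 'a list) \<times> (nat \<Rightarrow> real)" by (simp add: relabel_def)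
  have PQ': "vertex_map (\<lambda>x. x) P Q" using PQ by (simp add: vertex_map_def)
  have sub: "p \<in> topspace (simplex_coproduct (vcomplex Q))" if "p \<in> topspace (simplex_coproduct (vcomplex P))" for p
    using relabel_in_topspace[OF PQ' that] by (simp add: id)
  have incl: "?\<iota> (rcls (vcomplex P) p) = rcls (vcomplex Q) p" if "p \<in> topspace (simplex_coproduct (vcomplex P))" for p
    using vmap_rcls[OF PQ' that] by (simp add: id)
  have occQ: "rcls (vcomplex Q) p = rcls (vcomplex Q) q \<longleftrightarrow> (\<forall>b. \<forall>r\<ge>0. occ (weighted p) b r = occ (weighted q) b r)"
    if "p \<in> topspace (simplex_coproduct (vcomplex Q))" "q \<in> topspace (simplex_coproduct (vcomplex Q))" for p q
    using rcls_eq_iff[OF that] realization_rel_iff[OF Q that] by simp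
  have occP: "rcls (vcomplex P) p = rcls (vcomplex P) q \<longleftrightarrow> (\<forall>b. \<forall>r\<ge>0. occ (weighted p) b r = occ (weighted q) b r)"
    if "p \<in> topspace (simplex_coproduct (vcomplex P))" "q \<in> topspace (simplex_coproduct (vcomplex P))" for p q
    using rcls_eq_iff[OF that] realization_rel_iff[OF P that] by simp
  show "closedin (realization (vcomplex Q)) (?\<iota> ` F)"
    unfolding closedin_realization
  proof (intro conjI allI ballI)
    have "F \<subseteq> topspace (realization (vcomplex P))" using F closedin_subset by blast
    then show "?\<iota> ` F \<subseteq> topspace (realization (vcomplex Q))"
      using sub incl by (auto simp: topspace_realization)
    fix n xs assume "xs \<in> simplices (vcomplex Q) n"
    then have xs: "length xs = Suc n" "Q (set xs)" by auto
    \<comment> \<open>Entries of weight zero are irrelevant, so on the face of \<open>\<Delta>\<^sup>n\<close> spanned by \<open>J\<close> the word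
      \<open>xs\<close> may be replaced by \<open>ys J\<close>, whose letters are those of \<open>xs\<close> with index in \<open>J\<close>.\<close>
    define ys where "ys J = map (\<lambda>i. xs ! (if i \<in> J then i else SOME j. j \<in> J)) [0..<Suc n]" for J
    define \<J> where "\<J> = {J. J \<subseteq> {..n} \<and> J \<noteq> {} \<and> P ((!) xs ` J)}"
    have ys: "length (ys J) = Suc n" "set (ys J) = (!) xs ` J" "\<And>i. i \<in> J \<Longrightarrow> ys J ! i = xs ! i"
      "P (set (ys J))" if "J \<in> \<J>" for J
    proof -
      have J: "J \<subseteq> {..n}" "(SOME j. j \<in> J) \<in> J" "P ((!) xs ` J)"
        using that some_in_eq[of J] by (auto simp: \<J>_def)
      show "length (ys J) = Suc n" by (simp add: ys_def)
      show "set (ys J) = (!) xs ` J" using J unfolding ys_def set_map set_upt by (fastforce simp: image_iff)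
      then show "P (set (ys J))" using J by simp
      show "ys J ! i = xs ! i" if "i \<in> J" for i
        using that J by (auto simp: ys_def less_Suc_eq_le subset_iff simp del: upt_Suc)
    qed
    have same: "occ (weighted ((n, ys J), t)) b r = occ (weighted ((n, xs), t)) b r"
      if "J \<in> \<J>" "t \<in> standard_simplex n" "\<forall>i\<in>{..n} - J. t i = 0" "0 \<le> r" for J t b r
      unfolding weighted_def fst_conv snd_conv using that ys[OF that(1)] xs
      by (intro occ_zip_cong) (auto simp: standard_simplex_def less_Suc_eq_le simp del: upt_Suc)
    let ?T = "subtopology (powertop_real UNIV) (standard_simplex n)"
    let ?Z = "\<lambda>J. {t \<in> standard_simplex n. \<forall>i\<in>{..n} - J. t i = 0} \<inter>
        {t \<in> standard_simplex n. rcls (vcomplex P) ((n, ys J), t) \<in> F}"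
    have "{t \<in> standard_simplex n. rcls (vcomplex Q) ((n, xs), t) \<in> ?\<iota> ` F} = (\<Union>J\<in>\<J>. ?Z J)"
    proof (intro equalityI subsetI)
      fix t assume "t \<in> (\<Union>J\<in>\<J>. ?Z J)"
      then obtain J where J: "J \<in> \<J>" "t \<in> standard_simplex n" "\<forall>i\<in>{..n} - J. t i = 0"
        "rcls (vcomplex P) ((n, ys J), t) \<in> F" by blast
      have top: "((n, ys J), t) \<in> topspace (simplex_coproduct (vcomplex P))"
        using ys[OF J(1)] J by (simp add: topspace_simplex_coproduct)
      have top': "((n, xs), t) \<in> topspace (simplex_coproduct (vcomplex Q))"
        using xs J by (simp add: topspace_simplex_coproduct)
      have "rcls (vcomplex Q) ((n, xs), t) = ?\<iota> (rcls (vcomplex P) ((n, ys J), t))"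
        using occQ[OF sub[OF top] top'] same[OF J(1-3)] incl[OF top] by simp
      then show "t \<in> {t \<in> standard_simplex n. rcls (vcomplex Q) ((n, xs), t) \<in> ?\<iota> ` F}"
        using J by blast
    next
      fix t assume "t \<in> {t \<in> standard_simplex n. rcls (vcomplex Q) ((n, xs), t) \<in> ?\<iota> ` F}"
      then obtain c where t: "t \<in> standard_simplex n" and c: "c \<in> F" "rcls (vcomplex Q) ((n, xs), t) = ?\<iota> c" by blast
      then obtain q where q: "c = rcls (vcomplex P) q" "q \<in> topspace (simplex_coproduct (vcomplex P))"
        using closedin_subset[OF F] by (auto simp: topspace_realization)
      have top': "((n, xs), t) \<in> topspace (simplex_coproduct (vcomplex Q))"
        using xs t by (simp add: topspace_simplex_coproduct)
      have eq: "occ (weighted ((n, xs), t)) b r = occ (weighted q) b r" if "0 \<le> r" for b r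
        using occQ[OF top' sub[OF q(2)]] c incl[OF q(2)] q(1) that by simp
      \<comment> \<open>The support of \<open>t\<close>. Its vertices are the letters of the class,
        hence also of \<open>q\<close>, which lies in the complex of \<open>P\<close>.\<close>
      define J where "J = {i. i \<le> n \<and> 0 < t i}"
      have "(!) xs ` J = letters (weighted q)"
        using letters_weighted[OF xs(1), of t]
          letters_cong[OF weighted_in_weighted[OF top'] weighted_in_weighted[OF q(2)]] eq by (simp add: J_def)
      moreover have "P (fst ` set (weighted q))"
        using weighted_in_weighted[OF q(2)] by (simp add: weighted_in_def)
      ultimately have PJ: "P ((!) xs ` J)" using antimonoD[OF P letters_subset[of "weighted q"]] by simp
      have "J \<noteq> {}"
      proof
        assume "J = {}"
        then have "\<forall>i\<le>n. t i = 0" using t by (auto simp: J_def standard_simplex_def not_less intro: antisym)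
        then have "sum t {..n} = 0" by simp
        then show False using t by (simp add: standard_simplex_def)
      qed
      then have J: "J \<in> \<J>" using PJ by (auto simp: \<J>_def J_def)
      have supp: "\<forall>i\<in>{..n} - J. t i = 0" using t by (auto simp: J_def standard_simplex_def not_less intro: antisym)
      have top: "((n, ys J), t) \<in> topspace (simplex_coproduct (vcomplex P))"
        using ys[OF J] t by (simp add: topspace_simplex_coproduct)
      have "rcls (vcomplex P) ((n, ys J), t) = c"
        using occP[OF top q(2)] same[OF J t supp] eq q(1) by simp
      then show "t \<in> (\<Union>J\<in>\<J>. ?Z J)" using J t supp c by blast
    qed
    moreover have "closedin ?T (\<Union>J\<in>\<J>. ?Z J)"
    proof (rule closedin_Union)
      show "finite (?Z ` \<J>)" unfolding \<J>_def by (intro finite_imageI finite_subset[OF _ finite_Pow_iff[THEN iffD2, of "{..n}"]]) auto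
      fix S assume "S \<in> ?Z ` \<J>"
      then obtain J where J: "J \<in> \<J>" and S: "S = ?Z J" by blast
      \<comment> \<open>The extra index \<open>Suc n\<close> keeps the intersection nonempty when
        \<open>J\<close> is all of \<open>{..n}\<close>; its condition holds throughout the
        simplex.\<close>
      have "{t \<in> standard_simplex n. \<forall>i\<in>{..n} - J. t i = 0}
          = (\<Inter>i\<in>insert (Suc n) ({..n} - J). {t \<in> topspace ?T. t i \<in> {0}})"
        by (auto simp: standard_simplex_def)
      moreover have "closedin ?T (\<Inter>i\<in>insert (Suc n) ({..n} - J). {t \<in> topspace ?T. t i \<in> {0}})"
        by (intro closedin_INT closedin_continuous_map_preimage[of _ euclideanreal]
            continuous_map_from_subtopology continuous_map_product_projection) auto
      moreover have "closedin ?T {t \<in> standard_simplex n. rcls (vcomplex P) ((n, ys J), t) \<in> F}"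
        using F ys[OF J] unfolding closedin_realization by simp
      ultimately show "closedin ?T S" unfolding S by (simp only: closedin_Int)
    qed
    ultimately show "closedin ?T {t \<in> standard_simplex n. rcls (vcomplex Q) ((n, xs), t) \<in> ?\<iota> ` F}" by simp
  qed
qed

text \<open>Equality of points is decided by \<open>occ\<close> in both realizations, and
  \<open>occ\<close> does not see the complex.\<close>

lemma inj_on_incl:
  assumes "antimono P" "antimono Q" "\<And>A. P A \<Longrightarrow> Q A"
  shows "inj_on (vmap (\<lambda>x. x) Q) (topspace (realization (vcomplex P)))"
proof (rule inj_onI)
  fix c d assume c: "c \<in> topspace (realization (vcomplex P))" and d: "d \<in> topspace (realization (vcomplex P))"
    and eq: "vmap (\<lambda>x. x) Q c = vmap (\<lambda>x. x) Q d"
  obtain p where p: "c = rcls (vcomplex P) p" "p \<in> topspace (simplex_coproduct (vcomplex P))"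
    using c by (auto simp: topspace_realization)
  obtain q where q: "d = rcls (vcomplex P) q" "q \<in> topspace (simplex_coproduct (vcomplex P))"
    using d by (auto simp: topspace_realization)
  have PQ: "vertex_map (\<lambda>x. x) P Q" using assms(3) by (simp add: vertex_map_def)
  have id: "relabel (\<lambda>x. x) p = p" "relabel (\<lambda>x. x) q = q" by (simp_all add: relabel_def)
  have top: "p \<in> topspace (simplex_coproduct (vcomplex Q))" "q \<in> topspace (simplex_coproduct (vcomplex Q))"
    using relabel_in_topspace[OF PQ p(2)] relabel_in_topspace[OF PQ q(2)] by (simp_all add: id)
  have "rcls (vcomplex Q) p = rcls (vcomplex Q) q"
    using eq vmap_rcls[OF PQ p(2)] vmap_rcls[OF PQ q(2)] by (simp add: p(1) q(1) id)
  then show "c = d"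
    using rcls_eq_iff[OF top] rcls_eq_iff[OF p(2) q(2)] realization_rel_iff[OF assms(2) top]
      realization_rel_iff[OF assms(1) p(2) q(2)] by (simp add: p(1) q(1))
qed

section \<open>Compact images in increasing unions of subcomplexes\<close>

text \<open>If the image of \<open>f\<close> were not contained in a stage, it would contain a sequence with finitely
  many terms in each stage, so that all tails of the sequence would be closed.\<close>

lemma continuous_map_lift_stage:
  fixes P :: "nat \<Rightarrow> 'a set \<Rightarrow> bool"
  assumes P: "\<And>m. antimono (P m)" and Q: "antimono Q" and PQ: "\<And>m A. P m A \<Longrightarrow> Q A"
    and mono: "\<And>m m' A. \<lbrakk>m \<le> m'; P m A\<rbrakk> \<Longrightarrow> P m' A" and exh: "\<And>A. \<lbrakk>finite A; Q A\<rbrakk> \<Longrightarrow> \<exists>m. P m A"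
    and K: "compact_space K" and f: "continuous_map K (realization (vcomplex Q)) f"
  obtains m g where "continuous_map K (realization (vcomplex (P m))) g"
    "\<And>z. z \<in> topspace K \<Longrightarrow> vmap (\<lambda>x. x) Q (g z) = f z"
proof -
  let ?\<iota> = "vmap (\<lambda>x. x) Q" and ?X = "realization (vcomplex Q)"
  have vm: "vertex_map (\<lambda>x. x) (P m) Q" for m using PQ by (simp add: vertex_map_def)
  have stage: "rcls (vcomplex Q) ((n, xs), t) \<in> ?\<iota> ` topspace (realization (vcomplex (P m)))"
    if "length xs = Suc n" "P m (set xs)" "t \<in> standard_simplex n" for n xs t m
  proof -
    have top: "((n, xs), t) \<in> topspace (simplex_coproduct (vcomplex (P m)))"
      using that by (simp add: topspace_simplex_coproduct)
    have "?\<iota> (rcls (vcomplex (P m)) ((n, xs), t)) = rcls (vcomplex Q) ((n, xs), t)"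
      using vmap_rcls[OF vm top] by (simp add: relabel_def)
    then show ?thesis using top by (metis image_eqI topspace_realization)
  qed
  have "\<exists>m. f ` topspace K \<subseteq> ?\<iota> ` topspace (realization (vcomplex (P m)))"
  proof (rule ccontr)
    assume "\<nexists>m. f ` topspace K \<subseteq> ?\<iota> ` topspace (realization (vcomplex (P m)))"
    then have "\<forall>m. \<exists>z. z \<in> topspace K \<and> f z \<notin> ?\<iota> ` topspace (realization (vcomplex (P m)))" by blast
    then obtain z where z: "\<And>m. z m \<in> topspace K" "\<And>m. f (z m) \<notin> ?\<iota> ` topspace (realization (vcomplex (P m)))"
      by metis
    have fz: "f w \<in> topspace ?X" if "w \<in> topspace K" for w
      using f that by (auto simp: continuous_map_def)
    have bound: "m < i" if "length xs = Suc n" "P i (set xs)" "t \<in> standard_simplex n"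
      "f (z m) = rcls (vcomplex Q) ((n, xs), t)" for n xs t i m
    proof (rule ccontr)
      assume "\<not> m < i"
      then have "P m (set xs)" using mono[of i m] that by simp
      from stage[OF that(1) this that(3)] show False using z(2)[of m] that(4) by simp
    qed
    define S where "S j = (\<lambda>m. f (z m)) ` {j..}" for j
    have closed: "closedin ?X (S j)" for j
      unfolding closedin_realization
    proof (intro conjI allI ballI)
      show "S j \<subseteq> topspace ?X" using fz z(1) by (auto simp: S_def)
      fix n xs assume "xs \<in> simplices (vcomplex Q) n"
      then have xs: "length xs = Suc n" "Q (set xs)" by auto
      obtain i where i: "P i (set xs)" using exh[OF _ xs(2)] by auto
      have "{t \<in> standard_simplex n. rcls (vcomplex Q) ((n, xs), t) \<in> S j}
          = (\<Union>m\<in>{j..<i}. {t \<in> standard_simplex n. rcls (vcomplex Q) ((n, xs), t) = f (z m)})"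
        using bound[OF xs(1) i] by (fastforce simp: S_def)
      moreover have "closedin (subtopology (powertop_real UNIV) (standard_simplex n))
          {t \<in> standard_simplex n. rcls (vcomplex Q) ((n, xs), t) = f (z m)}" for m
      proof -
        obtain p where p: "f (z m) = rcls (vcomplex Q) p" "p \<in> topspace (simplex_coproduct (vcomplex Q))"
          using fz[OF z(1), of m] unfolding topspace_realization by blast
        show ?thesis unfolding p(1) by (rule closedin_rcls_eq[OF Q xs p(2)])
      qed
      ultimately show "closedin (subtopology (powertop_real UNIV) (standard_simplex n))
          {t \<in> standard_simplex n. rcls (vcomplex Q) ((n, xs), t) \<in> S j}"
        by (auto intro!: closedin_Union)
    qed
    define C where "C j = {w \<in> topspace K. f w \<in> S j}" for j
    have "closedin K (C j)" for j unfolding C_def by (rule closedin_continuous_map_preimage[OF f closed])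
    moreover have "C j \<noteq> {}" for j using z(1) by (auto simp: C_def S_def)
    moreover have "decseq C" by (auto simp: decseq_def C_def S_def)
    \<comment> \<open>A common point of the nested closed sets is mapped into every tail, but its
      image lies in some stage \<open>i\<close>, which all terms from \<open>i\<close> on
      avoid.\<close>
    ultimately have "(\<Inter>j. C j) \<noteq> {}" using compact_space_imp_nest[OF K] by blast
    then obtain w where w: "\<And>j. w \<in> C j" by blast
    then have "f w \<in> topspace ?X" using fz by (simp add: C_def)
    then obtain n xs t where wt: "f w = rcls (vcomplex Q) ((n, xs), t)" "length xs = Suc n" "Q (set xs)" "t \<in> standard_simplex n"
      by (auto simp: topspace_realization topspace_simplex_coproduct)
    obtain i where i: "P i (set xs)" using exh[OF _ wt(3)] by auto
    obtain m where "i \<le> m" "f (z m) = f w" using w[of i] by (auto simp: C_def S_def)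
    then show False using bound[OF wt(2) i wt(4)] wt(1) by fastforce
  qed
  then obtain m where m: "f ` topspace K \<subseteq> ?\<iota> ` topspace (realization (vcomplex (P m)))" by blast
  \<comment> \<open>Being injective, continuous and closed, the inclusion has a continuous inverse
    on its image, which lifts \<open>f\<close>.\<close>
  have "embedding_map (realization (vcomplex (P m))) ?X ?\<iota>"
    using continuous_map_vmap[OF vm] closed_map_incl[OF P Q PQ] inj_on_incl[OF P Q PQ]
    by (rule injective_closed_imp_embedding_map)
  then obtain h where h: "homeomorphic_maps (realization (vcomplex (P m)))
      (subtopology ?X (?\<iota> ` topspace (realization (vcomplex (P m))))) ?\<iota> h"
    unfolding embedding_map_def homeomorphic_map_maps by blast
  have fs: "continuous_map K (subtopology ?X (?\<iota> ` topspace (realization (vcomplex (P m))))) f"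
    using f m by (auto simp: continuous_map_in_subtopology)
  show ?thesis
  proof (rule that)
    show "continuous_map K (realization (vcomplex (P m))) (h \<circ> f)"
      using fs h unfolding homeomorphic_maps_def by (blast intro: continuous_map_compose)
    fix w assume "w \<in> topspace K"
    then have "f w \<in> topspace (subtopology ?X (?\<iota> ` topspace (realization (vcomplex (P m)))))"
      using fs by (auto simp: continuous_map_def)
    then show "?\<iota> ((h \<circ> f) w) = f w" using h by (simp add: homeomorphic_maps_def)
  qed
qed

text \<open>The edge is traversed by barycentric coordinates. At each end one weight vanishes, and
  \<open>occ\<close> identifies the end with a vertex.\<close>

lemma edge_path:
  assumes P: "antimono P" and "P {a, b}"
  shows "path_component_of (realization (vcomplex P)) (realization_vertex (vcomplex P) [a]) (realization_vertex (vcomplex P) [b])"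
proof -
  let ?X = "realization (vcomplex P)" and ?T = "subtopology (powertop_real UNIV) (standard_simplex (Suc 0))"
  define t :: "real \<Rightarrow> nat \<Rightarrow> real" where "t s i = (if i = 0 then 1 - s else if i = 1 then s else 0)" for s i
  have t: "t s \<in> standard_simplex (Suc 0)" if "s \<in> {0..1}" for s
    using that by (auto simp: t_def standard_simplex_def)
  have top: "((Suc 0, [a, b]), t s) \<in> topspace (simplex_coproduct (vcomplex P))" if "s \<in> {0..1}" for s
    using t[OF that] assms(2) by (simp add: topspace_simplex_coproduct)
  have "continuous_map (top_of_set {0..1}) ?T t"
    unfolding continuous_map_in_subtopology
  proof
    have "continuous_map (top_of_set {0..1}) euclideanreal (\<lambda>s. t s i)" for i
      by (cases "i = 0"; cases "i = 1") (auto simp: t_def continuous_map_iff_continuous intro!: continuous_intros)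
    then show "continuous_map (top_of_set {0..1}) (powertop_real UNIV) t"
      by (simp add: continuous_map_componentwise_UNIV)
  qed (use t in auto)
  moreover have "continuous_map ?T (simplex_coproduct (vcomplex P)) (\<lambda>u. ((Suc 0, [a, b]), u))"
    using continuous_map_component_injection[of "(Suc 0, [a, b])" "SIGMA n:UNIV. simplices (vcomplex P) n"
        "\<lambda>(n, x). subtopology (powertop_real UNIV) (standard_simplex n)"] assms(2)
    by (simp add: simplex_coproduct_def)
  ultimately have "continuous_map (top_of_set {0..1}) ?X (rcls (vcomplex P) \<circ> ((\<lambda>u. ((Suc 0, [a, b]), u)) \<circ> t))"
    using quotient_imp_continuous_map[OF quotient_map_rcls] by (blast intro: continuous_map_compose)
  moreover have "rcls (vcomplex P) ((Suc 0, [a, b]), t 0) = realization_vertex (vcomplex P) [a]"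
    "rcls (vcomplex P) ((Suc 0, [a, b]), t 1) = realization_vertex (vcomplex P) [b]"
  proof -
    have v: "vertex_point c \<in> topspace (simplex_coproduct (vcomplex P))" if "c \<in> {a, b}" for c
      using that antimonoD[OF P, of "{c}" "{a, b}"] assms(2) by (intro vertex_point_in_topspace) auto
    have w: "weighted (vertex_point c) = [(c, 1)]" "weighted ((Suc 0, [a, b]), t s) = [(a, 1 - s), (b, s)]" for c s
      by (simp_all add: weighted_def t_def)
    show "rcls (vcomplex P) ((Suc 0, [a, b]), t 0) = realization_vertex (vcomplex P) [a]"
      unfolding realization_vertex_eq rcls_eq_iff[OF top[of 0, simplified] v[of a, simplified]]
      by (subst realization_rel_iff[OF P top[of 0, simplified] v[of a, simplified]]) (simp add: w)
    show "rcls (vcomplex P) ((Suc 0, [a, b]), t 1) = realization_vertex (vcomplex P) [b]"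
      unfolding realization_vertex_eq rcls_eq_iff[OF top[of 1, simplified] v[of b, simplified]]
      by (subst realization_rel_iff[OF P top[of 1, simplified] v[of b, simplified]]) (simp add: w)
  qed
  ultimately show ?thesis
    unfolding path_component_of_def pathin_def
    by (intro exI[of _ "rcls (vcomplex P) \<circ> ((\<lambda>u. ((Suc 0, [a, b]), u)) \<circ> t)"]) simp
qed

section \<open>Changing the base point of a sphere\<close>

text \<open>Distance from the centre in the maximum norm, scaled so that the boundary has radius 1.
  For \<open>k = 0\<close> it is constantly 0, in accordance with the empty boundary of a
  point.\<close>

fun radius :: "nat \<Rightarrow> (nat \<Rightarrow> real) \<Rightarrow> real" where
  "radius 0 u = 0"
| "radius (Suc k) u = max (radius k u) \<bar>2 * u k - 1\<bar>"

text \<open>The homothety about the centre; the restriction makes its values extensional, as points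
  of \<open>cube k\<close> are.\<close>

definition rescale :: "nat \<Rightarrow> real \<Rightarrow> (nat \<Rightarrow> real) \<Rightarrow> nat \<Rightarrow> real" where
  "rescale k \<rho> u = (\<lambda>i\<in>{..<k}. 1/2 + \<rho> * (u i - 1/2))"

lemma radius_le_iff: "radius k u \<le> r \<longleftrightarrow> 0 \<le> r \<and> (\<forall>i<k. \<bar>2 * u i - 1\<bar> \<le> r)"
  by (induction k) (auto simp: less_Suc_eq)

lemma radius_nonneg: "0 \<le> radius k u"
  using radius_le_iff[of k u "radius k u"] by simp

lemma topspace_cube: "u \<in> topspace (cube k) \<longleftrightarrow> u \<in> extensional {..<k} \<and> radius k u \<le> 1"
  by (auto simp: cube_def PiE_def Pi_def radius_le_iff abs_le_iff)

lemma radius_attained: "0 < radius k u \<Longrightarrow> \<exists>i<k. radius k u = \<bar>2 * u i - 1\<bar>"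
  by (induction k) (auto simp: max_def less_Suc_eq)

lemma cube_boundary_iff: "u \<in> cube_boundary k \<longleftrightarrow> u \<in> topspace (cube k) \<and> radius k u = 1"
proof
  assume u: "u \<in> cube_boundary k"
  then obtain i where "i < k" "u i = 0 \<or> u i = 1" by (auto simp: cube_boundary_def)
  then have "1 \<le> radius k u" using radius_le_iff[of k u "radius k u"] by auto
  then show "u \<in> topspace (cube k) \<and> radius k u = 1"
    using u by (auto simp: cube_boundary_def topspace_cube)
next
  assume u: "u \<in> topspace (cube k) \<and> radius k u = 1"
  then obtain i where "i < k" "\<bar>2 * u i - 1\<bar> = 1" using radius_attained[of k u] by auto
  then have "u i = 0 \<or> u i = 1" by (auto simp: abs_if split: if_splits)
  then show "u \<in> cube_boundary k" using u \<open>i < k\<close> by (auto simp: cube_boundary_def)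
qed

lemma radius_rescale: "radius k (rescale m \<rho> u) = \<bar>\<rho>\<bar> * radius k u" if "k \<le> m"
  using that
proof (induction k)
  case (Suc k)
  have "2 * rescale m \<rho> u k - 1 = \<rho> * (2 * u k - 1)" using Suc.prems by (simp add: rescale_def algebra_simps)
  then show ?case using Suc by (simp add: abs_mult max_mult_distrib_left)
qed simp

lemma rescale_in_cube: "\<bar>\<rho>\<bar> * radius k u \<le> 1 \<Longrightarrow> rescale k \<rho> u \<in> topspace (cube k)"
  by (simp add: topspace_cube radius_rescale) (simp add: rescale_def)

lemma rescale_rescale: "rescale k \<rho> (rescale k \<sigma> u) = rescale k (\<rho> * \<sigma>) u"
  by (auto simp: rescale_def fun_eq_iff)

lemma rescale_1: "u \<in> topspace (cube k) \<Longrightarrow> rescale k 1 u = u"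
  by (auto simp: rescale_def fun_eq_iff topspace_cube extensional_def)

lemma continuous_map_cube_component:
  "continuous_map X (cube k) u \<Longrightarrow> i < k \<Longrightarrow> continuous_map X euclideanreal (\<lambda>z. u z i)"
  by (auto simp: cube_def continuous_map_componentwise continuous_map_in_subtopology)

lemma continuous_map_radius:
  assumes "continuous_map X (cube k) u"
  shows "continuous_map X euclideanreal (\<lambda>z. radius k (u z))"
proof -
  have "continuous_map X euclideanreal (\<lambda>z. radius m (u z))" if "m \<le> k" for m
    using that
    by (induction m) (auto intro!: continuous_map_real_max continuous_map_real_abs continuous_map_diff
        continuous_map_real_mult continuous_map_cube_component[OF assms])
  then show ?thesis by blast
qed

lemma continuous_map_rescale:
  assumes "continuous_map X (cube k) u" "continuous_map X euclideanreal \<rho>"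
    "\<And>z. z \<in> topspace X \<Longrightarrow> \<bar>\<rho> z\<bar> * radius k (u z) \<le> 1"
  shows "continuous_map X (cube k) (\<lambda>z. rescale k (\<rho> z) (u z))"
proof -
  have "continuous_map X (top_of_set {0..1}) (\<lambda>z. rescale k (\<rho> z) (u z) i)" if "i < k" for i
    unfolding continuous_map_in_subtopology
  proof
    show "continuous_map X euclideanreal (\<lambda>z. rescale k (\<rho> z) (u z) i)"
      using that unfolding rescale_def
      by (auto intro!: continuous_map_add continuous_map_real_mult continuous_map_diff assms
          continuous_map_cube_component[OF assms(1)])
    show "(\<lambda>z. rescale k (\<rho> z) (u z) i) \<in> topspace X \<rightarrow> {0..1}"
      using rescale_in_cube[OF assms(3)] that by (auto simp: cube_def PiE_def Pi_def)
  qed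
  then show ?thesis
    unfolding cube_def continuous_map_componentwise by (auto simp: rescale_def)
qed

abbreviation null_rel_boundary :: "nat \<Rightarrow> 'a topology \<Rightarrow> 'a \<Rightarrow> ((nat \<Rightarrow> real) \<Rightarrow> 'a) \<Rightarrow> bool" where
  "null_rel_boundary k T x f \<equiv> homotopic_with (\<lambda>h. \<forall>t\<in>cube_boundary k. h t = x) (cube k) T f (\<lambda>_. x)"

lemma homotopic_rel_boundary:
  "homotopic_with (\<lambda>h. \<forall>t\<in>cube_boundary k. h t = x) (cube k) T p q \<longleftrightarrow>
     (\<exists>h. continuous_map (prod_topology (top_of_set {0..1::real}) (cube k)) T h \<and>
        (\<forall>u\<in>topspace (cube k). h (0, u) = p u) \<and> (\<forall>u\<in>topspace (cube k). h (1, u) = q u) \<and>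
        (\<forall>s\<in>{0..1}. \<forall>u\<in>cube_boundary k. h (s, u) = x))"
  by (subst homotopic_with) (simp_all add: cube_boundary_iff)

text \<open>This makes the action of a path on spheres explicit, uniformly in \<open>k\<close>.
  Shrinking \<open>f\<close> to the concentric cube of half the size and running \<open>P\<close>
  backwards along the collar gives a sphere \<open>g\<close> at \<open>x\<close>; a null homotopy of
  its image is reshaped into one for \<open>f\<close>. For \<open>k = 0\<close> the collar is empty
  and the path is used only in the last homotopy.\<close>

lemma null_rel_boundary_change_base:
  fixes T :: "'a topology" and T' :: "'b topology"
  assumes i: "continuous_map T T' i" and P: "pathin T P" and P0: "P 0 = x" and P1: "P 1 = y"
    and null: "\<And>f. f \<in> based_maps k T x \<Longrightarrow> null_rel_boundary k T' (i x) (i \<circ> f)"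
    and f: "f \<in> based_maps k T y"
  shows "null_rel_boundary k T' (i y) (i \<circ> f)"
proof -
  let ?N = "radius k"
  let ?D = "prod_topology (top_of_set {0..1::real}) (cube k)"
  define g where "g u = (if ?N u \<le> 1/2 then f (rescale k 2 u) else P (2 - 2 * ?N u))" for u
  have fcont: "continuous_map (cube k) T f" and fy: "\<And>u. u \<in> cube_boundary k \<Longrightarrow> f u = y"
    using f by (auto simp: based_maps_def)
  have Pcont: "continuous_map X T (\<lambda>z. P (r z))"
    if "continuous_map X euclideanreal r" "\<And>z. z \<in> topspace X \<Longrightarrow> r z \<in> {0..1}" for X :: "'c topology" and r
  proof -
    have "continuous_map X (top_of_set {0..1}) r"
      using that by (simp add: continuous_map_in_subtopology Pi_iff)
    from continuous_map_compose[OF this P[unfolded pathin_def]] show ?thesis by (simp add: comp_def)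
  qed
  have Ncont: "continuous_map (cube k) euclideanreal ?N"
    using continuous_map_radius[OF continuous_map_id] by simp
  have Nle: "?N u \<le> 1" if "u \<in> topspace (cube k)" for u using that by (simp add: topspace_cube)
  have ghalf: "g u = P (2 - 2 * ?N u)" if "1/2 \<le> ?N u" for u
  proof (cases "?N u = 1/2")
    case True
    then have "rescale k 2 u \<in> cube_boundary k"
      by (simp add: cube_boundary_iff rescale_in_cube radius_rescale)
    then show ?thesis by (simp add: g_def True fy P1)
  qed (use that in \<open>simp add: g_def\<close>)
  have "g \<in> based_maps k T x"
    unfolding based_maps_def mem_Collect_eq
  proof
    show "continuous_map (cube k) T g"
      unfolding g_def
    proof (rule continuous_map_cases_le[OF Ncont])
      show "continuous_map (subtopology (cube k) {u \<in> topspace (cube k). ?N u \<le> 1/2}) T (\<lambda>u. f (rescale k 2 u))"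
      proof -
        have "continuous_map (subtopology (cube k) {u \<in> topspace (cube k). ?N u \<le> 1/2}) (cube k) (\<lambda>u. rescale k 2 u)"
          by (rule continuous_map_rescale) (auto simp: continuous_map_from_subtopology)
        from continuous_map_compose[OF this fcont] show ?thesis by (simp add: comp_def)
      qed
      show "continuous_map (subtopology (cube k) {u \<in> topspace (cube k). 1/2 \<le> ?N u}) T (\<lambda>u. P (2 - 2 * ?N u))"
        by (rule Pcont) (auto intro!: continuous_map_diff continuous_map_real_mult continuous_map_from_subtopology Ncont dest: Nle)
      show "f (rescale k 2 u) = P (2 - 2 * ?N u)" if "u \<in> topspace (cube k)" "?N u = 1/2" for u
        using ghalf[of u] by (simp add: g_def that)
    qed simp
    show "\<forall>u\<in>cube_boundary k. g u = x" by (simp add: cube_boundary_iff g_def P0)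
  qed
  from null[OF this, unfolded homotopic_rel_boundary] obtain H
    where H: "continuous_map ?D T' H"
      and H0: "\<And>u. u \<in> topspace (cube k) \<Longrightarrow> H (0, u) = i (g u)"
      and H1: "\<And>u. u \<in> topspace (cube k) \<Longrightarrow> H (1, u) = i x"
      and Hb: "\<And>s u. \<lbrakk>s \<in> {0..1}; u \<in> cube_boundary k\<rbrakk> \<Longrightarrow> H (s, u) = i x"
    by auto
  \<comment> \<open>In the prism on which \<open>H\<close> is defined, deform the inner half of the bottom face, where \<open>H\<close> is
    \<open>i \<circ> f\<close>, by straight lines and rel boundary onto the rest of the surface of the prism:
    \<open>\<rho>\<close> and \<open>height\<close> are the radial factor and the height of the image of a point of radius \<open>N\<close>.\<close>
  define \<rho> where "\<rho> N = min 1 (3/2 - N) / max (1/4) N" for N :: real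
  define height where "height N = min 1 (max 0 (2 - 4 * N))" for N :: real
  have \<rho>0: "0 \<le> \<rho> N" and \<rho>1: "\<rho> N * N \<le> 1" if "0 \<le> N" "N \<le> 1" for N
  proof -
    show "0 \<le> \<rho> N" using that by (simp add: \<rho>_def)
    have "min 1 (3/2 - N) * N \<le> 1 * max (1/4) N" using that by (intro mult_mono) auto
    then show "\<rho> N * N \<le> 1" by (simp add: \<rho>_def divide_simps)
  qed
  \<comment> \<open>The factor 1/2 at \<open>s = 0\<close> undoes the factor 2 in \<open>g\<close>,
    so the deformation starts at \<open>i \<circ> f\<close>; at \<open>s = 1\<close> the factor is
    \<open>\<rho>\<close>.\<close>
  define c where "c s N = (1 - s) / 2 + s * \<rho> N" for s N
  have c0: "0 \<le> c s N" and c1: "c s N * N \<le> 1" if "s \<in> {0..1}" "0 \<le> N" "N \<le> 1" for s N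
  proof -
    show "0 \<le> c s N" using that \<rho>0[of N] by (simp add: c_def)
    have "c s N * N = (1 - s) * (N / 2) + s * (\<rho> N * N)" by (simp add: c_def field_simps)
    also have "\<dots> \<le> (1 - s) * 1 + s * 1"
      using that \<rho>1[of N] by (intro add_mono mult_left_mono) auto
    finally show "c s N * N \<le> 1" by simp
  qed
  have crad: "\<bar>c s (?N u)\<bar> * ?N u \<le> 1" if "s \<in> {0..1}" "u \<in> topspace (cube k)" for s u
    using c0[of s "?N u"] c1[of s "?N u"] that radius_nonneg[of k u] Nle[of u] by simp
  have NcontD: "continuous_map ?D euclideanreal (\<lambda>z. ?N (snd z))"
    using continuous_map_radius[OF continuous_map_snd] .
  have scontD: "continuous_map ?D euclideanreal fst"
    using continuous_map_fst[of "top_of_set {0..1::real}" "cube k"] by (simp add: continuous_map_in_subtopology)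
  have "homotopic_with (\<lambda>h. \<forall>t\<in>cube_boundary k. h t = i y) (cube k) T' (i \<circ> f) (\<lambda>u. i (P (max 0 (2 * ?N u - 1))))"
    unfolding homotopic_rel_boundary
  proof (intro exI[of _ "\<lambda>(s, u). H (s * height (?N u), rescale k (c s (?N u)) u)"] conjI ballI)
    have "continuous_map ?D (top_of_set {0..1}) (\<lambda>z. fst z * height (?N (snd z)))"
      unfolding continuous_map_in_subtopology height_def
    proof
      show "(\<lambda>z. fst z * min 1 (max 0 (2 - 4 * ?N (snd z)))) \<in> topspace ?D \<rightarrow> {0..1}"
        by (auto intro!: mult_le_one)
    qed (intro continuous_map_real_mult continuous_map_real_min continuous_map_real_max continuous_map_diff
        scontD NcontD; simp)
    moreover have "continuous_map ?D (cube k) (\<lambda>z. rescale k (c (fst z) (?N (snd z))) (snd z))"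
    proof (rule continuous_map_rescale[OF continuous_map_snd])
      show "continuous_map ?D euclideanreal (\<lambda>z. c (fst z) (?N (snd z)))"
        unfolding c_def \<rho>_def
        by (intro continuous_map_add continuous_map_real_divide continuous_map_real_mult continuous_map_real_min
            continuous_map_real_max continuous_map_diff scontD NcontD) (auto simp: max_def)
    qed (use crad in auto)
    ultimately have "continuous_map ?D T' (\<lambda>z. H (fst z * height (?N (snd z)), rescale k (c (fst z) (?N (snd z))) (snd z)))"
      using continuous_map_compose[OF continuous_map_pairedI H] by (simp add: comp_def)
    then show "continuous_map ?D T' (\<lambda>(s, u). H (s * height (?N u), rescale k (c s (?N u)) u))"
      by (simp add: case_prod_unfold)
  next
    fix u assume u: "u \<in> topspace (cube k)"
    have "rescale k (1/2) u \<in> topspace (cube k)" using Nle[OF u] by (intro rescale_in_cube) simp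
    then show "(case (0, u) of (s, u) \<Rightarrow> H (s * height (?N u), rescale k (c s (?N u)) u)) = (i \<circ> f) u"
      using Nle[OF u] u by (simp add: H0 c_def g_def radius_rescale rescale_rescale rescale_1)
  next
    fix u assume u: "u \<in> topspace (cube k)"
    let ?v = "rescale k (\<rho> (?N u)) u"
    have N: "0 \<le> ?N u" "?N u \<le> 1" using radius_nonneg Nle[OF u] by auto
    have v: "?v \<in> topspace (cube k)" "?N ?v = \<rho> (?N u) * ?N u"
      using \<rho>0[OF N] \<rho>1[OF N] by (auto intro!: rescale_in_cube simp: radius_rescale)
    \<comment> \<open>The three zones land on the outer half of the bottom, where radius
      \<open>N\<close> goes to 3/2 - \<open>N\<close>, on the side, and on the top. On the side and
      the top \<open>H\<close> is constantly \<open>i x\<close>; on the bottom it follows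
      \<open>P\<close>.\<close>
    consider "1/2 \<le> ?N u" | "1/4 \<le> ?N u" "?N u \<le> 1/2" | "?N u \<le> 1/4" by linarith
    then have "H (height (?N u), ?v) = i (P (max 0 (2 * ?N u - 1)))"
    proof cases
      case 1
      then have "?N ?v = 3/2 - ?N u" "height (?N u) = 0" using N v(2) by (auto simp: \<rho>_def height_def)
      moreover from this have "2 - 2 * ?N ?v = max 0 (2 * ?N u - 1)" using 1 by simp
      ultimately show ?thesis using H0[OF v(1)] ghalf[of ?v] N by simp
    next
      case 2
      then have "?N ?v = 1" using v(2) by (simp add: \<rho>_def)
      then have "?v \<in> cube_boundary k" using v by (simp add: cube_boundary_iff)
      moreover have "height (?N u) \<in> {0..1}" by (simp add: height_def)
      ultimately show ?thesis using 2 by (simp add: Hb P0)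
    next
      case 3
      then have "height (?N u) = 1" by (simp add: height_def)
      then show ?thesis using 3 v(1) by (simp add: H1 P0)
    qed
    then show "(case (1, u) of (s, u) \<Rightarrow> H (s * height (?N u), rescale k (c s (?N u)) u)) = i (P (max 0 (2 * ?N u - 1)))"
      by (simp add: c_def)
  next
    fix s :: real and u assume s: "s \<in> {0..1}" and u: "u \<in> cube_boundary k"
    then have u': "u \<in> topspace (cube k)" "?N u = 1" by (auto simp: cube_boundary_iff)
    have rim0: "rescale k (1/2) u \<in> topspace (cube k)" using u' by (intro rescale_in_cube) simp
    have rim: "c s 1 = 1/2" "height 1 = 0" by (simp_all add: c_def \<rho>_def height_def field_simps)
    show "(case (s, u) of (s, u) \<Rightarrow> H (s * height (?N u), rescale k (c s (?N u)) u)) = i y"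
      by (simp add: u' rim H0[OF rim0] ghalf radius_rescale P1)
  qed
  \<comment> \<open>What remains factors through the path, so it contracts by pushing its parameter
    up to 1; the boundary is already at the end \<open>y\<close>.\<close>
  moreover have "homotopic_with (\<lambda>h. \<forall>t\<in>cube_boundary k. h t = i y) (cube k) T'
      (\<lambda>u. i (P (max 0 (2 * ?N u - 1)))) (\<lambda>_. i y)"
    unfolding homotopic_rel_boundary
  proof (intro exI[of _ "\<lambda>(s, u). i (P (max s (max 0 (2 * ?N u - 1))))"] conjI ballI)
    have "continuous_map ?D T (\<lambda>z. P (max (fst z) (max 0 (2 * ?N (snd z) - 1))))"
      by (rule Pcont) (auto intro!: continuous_map_real_max continuous_map_diff continuous_map_real_mult
          scontD NcontD dest: Nle)
    then show "continuous_map ?D T' (\<lambda>(s, u). i (P (max s (max 0 (2 * ?N u - 1)))))"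
      using continuous_map_compose[OF _ i] by (fastforce simp: case_prod_unfold comp_def)
  qed (auto simp: cube_boundary_iff P1 dest: Nle)
  ultimately show ?thesis by (rule homotopic_with_trans)
qed

section \<open>Triviality on homotopy groups via null homotopies\<close>

lemma based_homotopy_rel_compose:
  assumes "continuous_map T T' \<phi>" "\<phi> x = y" "(f, g) \<in> based_homotopy_rel k T x"
  shows "(\<phi> \<circ> f, \<phi> \<circ> g) \<in> based_homotopy_rel k T' y"
proof -
  have "homotopic_with (\<lambda>h. \<forall>t\<in>cube_boundary k. h t = x) (cube k) T f g"
    using assms(3) by (simp add: based_homotopy_rel_def)
  then have "homotopic_with (\<lambda>h. \<forall>t\<in>cube_boundary k. h t = y) (cube k) T' (\<phi> \<circ> f) (\<phi> \<circ> g)"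
    by (rule homotopic_with_compose_continuous_map_left[OF _ assms(1)]) (simp add: assms(2))
  then show ?thesis
    using assms by (auto simp: based_homotopy_rel_def based_maps_def intro: continuous_map_compose)
qed

text \<open>Composition with \<open>\<phi>\<close> respects homotopy, so the image of a class stays
  within a single class, represented by \<open>\<phi> \<circ> f\<close>. This lets the argument
  handle individual spheres.\<close>

lemma homotopy_induced_trivial_iff:
  assumes \<phi>: "continuous_map T T' \<phi>" and x: "x \<in> topspace T" and y: "\<phi> x = y"
  shows "(\<forall>c\<in>homotopy_group k T x. homotopy_induced k T' y \<phi> c = homotopy_unit k T' y)
    \<longleftrightarrow> (\<forall>f\<in>based_maps k T x. null_rel_boundary k T' y (\<phi> \<circ> f))"
proof -
  let ?R = "based_homotopy_rel k T x" and ?R' = "based_homotopy_rel k T' y"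
  have "y \<in> topspace T'" using \<phi> x y by (auto simp: continuous_map_def)
  then have const: "(\<lambda>_. y) \<in> based_maps k T' y" by (simp add: based_maps_def)
  have "homotopy_induced k T' y \<phi> (?R `` {f}) = homotopy_unit k T' y \<longleftrightarrow> null_rel_boundary k T' y (\<phi> \<circ> f)"
    if f: "f \<in> based_maps k T x" for f
  proof -
    have ff: "(f, f) \<in> ?R" using f equiv_based_homotopy_rel by (metis equivE refl_onD)
    have \<phi>f: "\<phi> \<circ> f \<in> based_maps k T' y"
      using based_homotopy_rel_compose[OF \<phi> y ff] by (simp add: based_homotopy_rel_def)
    have "?R' `` ((\<circ>) \<phi> ` (?R `` {f})) = ?R' `` {\<phi> \<circ> f}"
    proof (intro equalityI subsetI)
      fix g assume "g \<in> ?R' `` ((\<circ>) \<phi> ` (?R `` {f}))"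
      then obtain f' where f': "(f, f') \<in> ?R" "(\<phi> \<circ> f', g) \<in> ?R'" by auto
      from based_homotopy_rel_compose[OF \<phi> y f'(1)] f'(2)
      have "(\<phi> \<circ> f, g) \<in> ?R'" using equiv_based_homotopy_rel[of k T' y] by (meson equivE transD)
      then show "g \<in> ?R' `` {\<phi> \<circ> f}" by simp
    qed (use ff in blast)
    then have "homotopy_induced k T' y \<phi> (?R `` {f}) = homotopy_unit k T' y \<longleftrightarrow> (\<phi> \<circ> f, \<lambda>_. y) \<in> ?R'"
      unfolding homotopy_induced_def homotopy_unit_def
      using eq_equiv_class_iff[OF equiv_based_homotopy_rel \<phi>f const] by simp
    then show ?thesis using \<phi>f const by (simp add: based_homotopy_rel_def)
  qed
  then show ?thesis unfolding homotopy_group_def quotient_def by simp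
qed

section \<open>Translates of compact subsets\<close>

definition covered :: "'g::group_add set \<Rightarrow> 'g set \<Rightarrow> 'g set \<Rightarrow> bool" where
  "covered K C A \<longleftrightarrow> (\<exists>g\<in>K. A \<subseteq> (+) g ` C)"

lemma translates_eq: "translates K C = vcomplex (covered K C)"
  using translates_eq_vcomplex[of K C] by (simp add: covered_def[abs_def])

lemma antimono_covered: "antimono (covered K C)"
  by (rule antimonoI) (auto simp: covered_def)

lemma covered_mono: "\<lbrakk>covered K C A; K \<subseteq> K'; C \<subseteq> C'\<rbrakk> \<Longrightarrow> covered K' C' A"
  unfolding covered_def by blast

lemma vertex_map_covered:
  assumes "\<And>h. h \<in> K \<Longrightarrow> g + h \<in> K'" "C \<subseteq> C'"
  shows "vertex_map ((+) g) (covered K C) (covered K' C')"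
  unfolding vertex_map_def covered_def
proof (intro allI impI)
  fix A assume "\<exists>h\<in>K. A \<subseteq> (+) h ` C"
  then obtain h where "h \<in> K" "A \<subseteq> (+) h ` C" by blast
  then have "g + h \<in> K'" "(+) g ` A \<subseteq> (+) (g + h) ` C'"
    using assms by (auto simp: image_subset_iff subset_iff add.assoc)
  then show "\<exists>h\<in>K'. (+) g ` A \<subseteq> (+) h ` C'" by blast
qed

lemma vertex_map_covered_id:
  assumes "K \<subseteq> K'" "C \<subseteq> C'"
  shows "vertex_map (\<lambda>x. x) (covered K C) (covered K' C')"
  using covered_mono[OF _ assms] by (simp add: vertex_map_def)

lemma character_zero:
  assumes "character \<xi>"
  shows "\<xi> 0 = 0"
proof -
  have "\<xi> (0 + 0) = \<xi> 0 + \<xi> 0" using assms unfolding character_def by blast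
  then show ?thesis by simp
qed

section \<open>Pushing spheres into the nonnegative part of a character\<close>

lemma essentially_connected_UNIV:
  fixes \<xi> :: "'g::topological_group_add \<Rightarrow> real"
  assumes \<xi>: "character \<xi>" and t: "0 < \<xi> t"
    and ess: "essentially_connected {C. compact C} (ESet UNIV) (translates {g. 0 \<le> \<xi> g}) m"
  shows "essentially_connected {C. compact C} (ESet UNIV) (translates (UNIV :: 'g set)) m"
  unfolding essentially_connected_def
proof (intro ballI allI impI)
  fix v :: "'g list" and k C
  assume v: "v \<in> simplices (ESet UNIV) 0" and k: "int k \<le> m" and C: "C \<in> {C. compact C}"
    and vC: "v \<in> simplices (translates UNIV C) 0"
  obtain a where a: "v = [a]" using v by (auto simp: ESet_def length_Suc_conv)
  have add: "\<xi> (g + h) = \<xi> g + \<xi> h" for g h using \<xi> by (simp add: character_def)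
  have neg: "\<xi> (- g) = - \<xi> g" for g using add[of "- g" g] character_zero[OF \<xi>] by simp
  define H where "H = {g. 0 \<le> \<xi> g}"
  \<comment> \<open>The vertex \<open>a\<close> may lie only in translates \<open>h + C\<close> with
    \<open>\<xi> h < 0\<close>, so it is adjoined to become a base vertex over \<open>H\<close>;
    with \<open>t + a\<close> the edges of the path are available too.\<close>
  define C' where "C' = C \<union> {a, t + a}"
  have aH: "covered H C' {a}" unfolding covered_def H_def C'_def
    using character_zero[OF \<xi>] by (intro bexI[of _ 0]) (auto intro!: image_eqI[of a _ a])
  have cH: "vcomplex (covered H B) = translates {g. 0 \<le> \<xi> g} B" for B by (simp add: translates_eq H_def)
  have C': "C' \<in> {C. compact C}" using C by (simp add: C'_def compact_Un)
  have "v \<in> simplices (translates {g. 0 \<le> \<xi> g} C') 0"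
    unfolding cH[symmetric] using aH by (simp add: a)
  then obtain D where D: "compact D" "C' \<subseteq> D"
    and triv: "\<forall>c\<in>homotopy_group k (realization (vcomplex (covered H C'))) (realization_vertex (vcomplex (covered H C')) v).
             homotopy_induced k (realization (vcomplex (covered H D))) (realization_vertex (vcomplex (covered H D)) v)
                 (realization_incl (vcomplex (covered H D))) c
               = homotopy_unit k (realization (vcomplex (covered H D))) (realization_vertex (vcomplex (covered H D)) v)"
    using ess[unfolded essentially_connected_def, rule_format, OF v k C'] unfolding cH by auto
  have CD: "C \<subseteq> D" using D(2) by (auto simp: C'_def)
  let ?HC = "covered H C'" and ?HD = "covered H D" and ?GC = "covered UNIV C" and ?GD = "covered UNIV D"
  let ?vert = "\<lambda>P b. realization_vertex (vcomplex P) [b]"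
  have incl: "vertex_map (\<lambda>x. x) ?HC ?HD" "vertex_map (\<lambda>x. x) ?GC ?GD"
    using D(2) CD by (auto intro: vertex_map_covered_id)
  have null: "null_rel_boundary k (realization (vcomplex ?HD)) (vmap (\<lambda>x. x) ?HD (?vert ?HC a)) (vmap (\<lambda>x. x) ?HD \<circ> f)"
    if "f \<in> based_maps k (realization (vcomplex ?HC)) (?vert ?HC a)" for f
    using triv that unfolding a realization_incl_vcomplex vmap_vertex[OF incl(1) aH, symmetric]
      homotopy_induced_trivial_iff[OF continuous_map_vmap[OF incl(1)]
        realization_vertex_in_topspace[of ?HC a, OF aH] refl] by blast
  have aG: "?GC {a}" using vC by (simp add: a translates_eq)
  then obtain h0 where h0: "{a} \<subseteq> (+) h0 ` C" by (auto simp: covered_def)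
  \<comment> \<open>The offset \<open>m0\<close> admits \<open>h0\<close>, so that already the first
    stage contains the base vertex.\<close>
  obtain m0 :: nat where m0: "- \<xi> h0 < real m0 * \<xi> t" using reals_Archimedean3[OF t] by blast
  define P where "P i = covered {g. - (real (m0 + i) * \<xi> t) \<le> \<xi> g} C" for i
  have Pmono: "P j A" if "i \<le> j" "P i A" for i j A
    unfolding P_def
  proof (rule covered_mono[OF that(2)[unfolded P_def]])
    have "real (m0 + i) * \<xi> t \<le> real (m0 + j) * \<xi> t" using that(1) t by (intro mult_right_mono) auto
    then show "{g. - (real (m0 + i) * \<xi> t) \<le> \<xi> g} \<subseteq> {g. - (real (m0 + j) * \<xi> t) \<le> \<xi> g}" by auto
  qed simp
  have aP: "P i {a}" for i
  proof -
    have "P 0 {a}" unfolding P_def covered_def using h0 m0 by (intro bexI[of _ h0]) auto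
    then show ?thesis using Pmono[of 0 i] by simp
  qed
  have PG: "?GC A" if "P i A" for i A using that by (auto simp: P_def covered_def)
  have exh: "\<exists>i. P i A" if GC: "?GC A" for A
  proof -
    obtain h where h: "A \<subseteq> (+) h ` C" using GC by (auto simp: covered_def)
    obtain i :: nat where i: "- \<xi> h < real i * \<xi> t" using reals_Archimedean3[OF t] by blast
    have "real i * \<xi> t \<le> real (m0 + i) * \<xi> t" using t by (intro mult_right_mono) auto
    then have "P i A" unfolding P_def covered_def using h i by (intro bexI[of _ h]) auto
    then show ?thesis ..
  qed
  have "null_rel_boundary k (realization (vcomplex ?GD)) (?vert ?GD a) (vmap (\<lambda>x. x) ?GD \<circ> f)"
    if f: "f \<in> based_maps k (realization (vcomplex ?GC)) (?vert ?GC a)" for f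
  proof -
    have fcont: "continuous_map (cube k) (realization (vcomplex ?GC)) f" using f by (simp add: based_maps_def)
    have "compact_space (cube k)"
      unfolding cube_def by (simp add: compact_space_product_topology compact_space_subtopology)
    moreover have antiP: "antimono (P i)" for i unfolding P_def by (rule antimono_covered)
    ultimately obtain i f1 where f1: "continuous_map (cube k) (realization (vcomplex (P i))) f1"
      "\<And>z. z \<in> topspace (cube k) \<Longrightarrow> vmap (\<lambda>x. x) ?GC (f1 z) = f z"
    proof (rule_tac continuous_map_lift_stage[of P ?GC "cube k" f, OF antiP antimono_covered])
      show "?GC A" if "P m A" for m A using PG[OF that] .
      show "P m' A" if "m \<le> m'" "P m A" for m m' A using Pmono[OF that] .
      show "\<exists>m. P m A" if "?GC A" for A using exh[OF that] .
    qed (use fcont in auto)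
    have f1top: "f1 z \<in> topspace (realization (vcomplex (P i)))" if "z \<in> topspace (cube k)" for z
      using f1(1) that by (auto simp: continuous_map_def)
    have PiG: "vertex_map (\<lambda>x. x) (P i) ?GC" using PG by (simp add: vertex_map_def)
    \<comment> \<open>Injectivity of the inclusion forces the lifted sphere to be based at
      \<open>a\<close>.\<close>
    have f1b: "f1 z = ?vert (P i) a" if z: "z \<in> cube_boundary k" for z
    proof -
      have z': "z \<in> topspace (cube k)" using z by (simp add: cube_boundary_def)
      have "vmap (\<lambda>x. x) ?GC (f1 z) = ?vert ?GC a" using f z f1(2)[OF z'] by (simp add: based_maps_def)
      also have "\<dots> = vmap (\<lambda>x. x) ?GC (?vert (P i) a)" using vmap_vertex[OF PiG aP] by simp
      finally show ?thesis
        using inj_onD[OF inj_on_incl[of "P i" ?GC, OF _ antimono_covered PG]] f1top[OF z']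
          realization_vertex_in_topspace[of "P i" a, OF aP] antiP by simp
    qed
    \<comment> \<open>The \<open>j\<close>-th power of \<open>t\<close>, built by adding
      \<open>t\<close> on the right so that the edge from \<open>shift j + a\<close> to
      \<open>shift (Suc j) + a\<close> is the left translate by \<open>shift j\<close> of the edge
      from \<open>a\<close> to \<open>t + a\<close>.\<close>
    define shift where "shift j = ((\<lambda>y. y + t) ^^ j) 0" for j
    have \<xi>shift: "\<xi> (shift j) = real j * \<xi> t" for j
      by (induction j) (auto simp: shift_def character_zero[OF \<xi>] add algebra_simps)
    \<comment> \<open>The value of \<xi> at \<open>g\<close> exactly offsets the lower bound
      defining stage \<open>i\<close>.\<close>
    define g where "g = shift (m0 + i)"
    have up: "vertex_map ((+) g) (P i) ?HC"
      unfolding P_def by (rule vertex_map_covered) (auto simp: H_def add g_def \<xi>shift C'_def)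
    have down: "vertex_map ((+) (- g)) ?HD ?GD" by (rule vertex_map_covered) auto
    let ?f' = "vmap ((+) g) ?HC \<circ> f1"
    have "continuous_map (cube k) (realization (vcomplex ?HC)) ?f'"
      using f1(1) continuous_map_vmap[OF up] by (rule continuous_map_compose)
    then have f': "?f' \<in> based_maps k (realization (vcomplex ?HC)) (?vert ?HC (g + a))"
      using f1b vmap_vertex[OF up aP] by (simp add: based_maps_def)
    have "path_component_of (realization (vcomplex ?HC)) (?vert ?HC a) (?vert ?HC (shift j + a))" for j
    proof (induction j)
      case 0
      show ?case using realization_vertex_in_topspace[of ?HC a, OF aH] by (simp add: shift_def path_component_of_refl)
    next
      case (Suc j)
      have "?HC {shift j + a, shift (Suc j) + a}"
        unfolding covered_def using t
        by (intro bexI[of _ "shift j"]) (auto simp: H_def \<xi>shift C'_def, simp add: shift_def add.assoc)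
      from path_component_of_trans[OF Suc edge_path[OF antimono_covered this]] show ?case .
    qed
    then obtain p where p: "pathin (realization (vcomplex ?HC)) p" "p 0 = ?vert ?HC a" "p 1 = ?vert ?HC (g + a)"
      unfolding path_component_of_def g_def by blast
    have ga: "?HC {g + a}" using vertex_mapD[OF up aP] by simp
    have "null_rel_boundary k (realization (vcomplex ?HD)) (vmap (\<lambda>x. x) ?HD (?vert ?HC (g + a))) (vmap (\<lambda>x. x) ?HD \<circ> ?f')"
      using continuous_map_vmap[OF incl(1)] p null f' by (rule null_rel_boundary_change_base)
    then have null': "null_rel_boundary k (realization (vcomplex ?HD)) (?vert ?HD (g + a)) (vmap (\<lambda>x. x) ?HD \<circ> ?f')"
      by (simp add: vmap_vertex[OF incl(1) ga])
    have base_back: "vmap ((+) (- g)) ?GD (?vert ?HD (g + a)) = ?vert ?GD a"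
      using vmap_vertex[OF down vertex_mapD[OF incl(1) ga, simplified]] by (simp add: add.assoc[symmetric])
    have hom: "homotopic_with (\<lambda>h. \<forall>z\<in>cube_boundary k. h z = ?vert ?GD a) (cube k) (realization (vcomplex ?GD))
        (vmap ((+) (- g)) ?GD \<circ> (vmap (\<lambda>x. x) ?HD \<circ> ?f')) (vmap ((+) (- g)) ?GD \<circ> (\<lambda>_. ?vert ?HD (g + a)))"
      by (rule homotopic_with_compose_continuous_map_left[OF null' continuous_map_vmap[OF down]]) (simp add: base_back)
    \<comment> \<open>The two translations cancel on vertices, so only the inclusion of
      \<open>C\<close> into \<open>D\<close> remains.\<close>
    have eq: "vmap ((+) (- g)) ?GD (vmap (\<lambda>x. x) ?HD (vmap ((+) g) ?HC (f1 z))) = vmap (\<lambda>x. x) ?GD (f z)"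
      if z: "z \<in> topspace (cube k)" for z
    proof -
      have "vmap (\<lambda>x. x) ?HD (vmap ((+) g) ?HC (f1 z)) = vmap ((+) g) ?HD (f1 z)"
        using vmap_vmap[OF up incl(1) f1top[OF z]] by simp
      moreover have "vertex_map ((+) g) (P i) ?HD"
        using up incl(1) by (simp add: vertex_map_def)
      ultimately have "vmap ((+) (- g)) ?GD (vmap (\<lambda>x. x) ?HD (vmap ((+) g) ?HC (f1 z))) = vmap (\<lambda>x. x) ?GD (f1 z)"
        using vmap_vmap[OF _ down f1top[OF z]] by (simp add: add.assoc[symmetric])
      also have "\<dots> = vmap (\<lambda>x. x) ?GD (f z)"
        using vmap_vmap[OF PiG incl(2) f1top[OF z]] f1(2)[OF z] by simp
      finally show ?thesis .
    qed
    show ?thesis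
      using hom by (rule homotopic_with_eq) (simp_all add: eq base_back cube_boundary_iff)
  qed
  then have "\<forall>c\<in>homotopy_group k (realization (vcomplex ?GC)) (?vert ?GC a).
      homotopy_induced k (realization (vcomplex ?GD)) (?vert ?GD a) (vmap (\<lambda>x. x) ?GD) c
      = homotopy_unit k (realization (vcomplex ?GD)) (?vert ?GD a)"
    using homotopy_induced_trivial_iff[OF continuous_map_vmap[OF incl(2)]
        realization_vertex_in_topspace[of ?GC a, OF aG] vmap_vertex[OF incl(2) aG]] by blast
  then show "\<exists>D\<in>{C. compact C}. C \<le> D \<and>
      (\<forall>c\<in>homotopy_group k (realization (translates UNIV C)) (realization_vertex (translates UNIV C) v).
             homotopy_induced k (realization (translates UNIV D)) (realization_vertex (translates UNIV D) v)
                 (realization_incl (translates UNIV D)) c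
               = homotopy_unit k (realization (translates UNIV D)) (realization_vertex (translates UNIV D) v))"
    unfolding translates_eq realization_incl_vcomplex a using D(1) CD by (intro bexI[of _ D]) auto
qed

theorem proposition3p5:
  fixes n :: nat
  assumes "locally_compact_space (euclidean :: 'g::{topological_group_add, t2_space} topology)"
  shows "(type_C TYPE('g) n \<longleftrightarrow> (\<lambda>_. 0) \<in> (Sigma_top n :: ('g \<Rightarrow> real) set))
       \<and> ((\<lambda>_. 0) \<in> (Sigma_top n :: ('g \<Rightarrow> real) set)
            \<longleftrightarrow> (Sigma_top n :: ('g \<Rightarrow> real) set) \<noteq> {})"
proof -
  \<comment> \<open>For the zero character the index set of translates is all of
    \<open>UNIV\<close>, so both sides unfold to the same condition.\<close>
  have zero: "type_C TYPE('g) n \<longleftrightarrow> (\<lambda>_. 0) \<in> (Sigma_top n :: ('g \<Rightarrow> real) set)"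
    by (simp add: type_C_def Sigma_top_def character_def)
  moreover have "type_C TYPE('g) n" if "\<xi> \<in> Sigma_top n" for \<xi> :: "'g \<Rightarrow> real"
  proof (cases "\<xi> = (\<lambda>_. 0)")
    case True
    then show ?thesis using that zero by simp
  next
    case False
    have \<xi>: "character \<xi>" and ess: "essentially_connected {C. compact C} (ESet UNIV) (translates {g. 0 \<le> \<xi> g}) (int n - 1)"
      using that by (auto simp: Sigma_top_def)
    obtain g where g: "\<xi> g \<noteq> 0" using False by blast
    \<comment> \<open>A nonzero value at \<open>g\<close> gives a positive value at \<open>g\<close>
      or at its inverse.\<close>
    have "\<xi> (g + - g) = \<xi> g + \<xi> (- g)" using \<xi> unfolding character_def by blast
    then have "\<xi> (- g) = - \<xi> g" using character_zero[OF \<xi>] by simp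
    then obtain t where "0 < \<xi> t" using g by (metis neg_0_less_iff_less linorder_neqE_linordered_idom)
    from essentially_connected_UNIV[OF \<xi> this ess] show ?thesis unfolding type_C_def .
  qed
  ultimately show ?thesis by blast
qed

end
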